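(* Let $(L,[-,-],d)$ be a differential Lie algebra of weight $\lambda$ and let $(L^{*},[-,-]_{*},D^{*})$ be a differential Lie algebra of weight $\lambda$ on the dual space, where $D:L\to L$ is linear and $D^*$ is its dual. Let $\delta:L\to L\otimes L$ be the linear dual of $[-,-]_*$. Then the following conditions are equivalent. (1) The triple $\big((L\oplus L^{*},[-,-]_{\oplus}^{\circ},d+D^{*}),L,L^{*}\big)$ is a Manin triple of differential Lie algebras. (2) The 5-tuple $(L,[-,-],d,\delta,D)$ is a differential Lie bialgebra. (3) The 6-tuple $(L,L^{*},d,D^{*},\mathfrak{ad}^{*},\mathrm{ad}^{*})$ is a matched pair of differential Lie algebras.
   Context: All vector spaces are finite-dimensional over a field $\mathbf k$, and $\lambda\in\mathbf k$ is fixed; $\langle\cdot,\cdot\rangle$ is the natural pairing of a space with its dual. **Differential Lie algebra of weight $\lambda$** $(L,[-,-],d)$: a Lie algebra with a linear map $d$ such that $d([x,y])=[d(x),y]+[x,d(y)]+\lambda[d(x),d(y)]$. A **representation** of it is $(V,\rho,\xi)$ with $(V,\rho)$ a representation of the Lie algebra and $\xi:V\to V$ linear such that $\xi(\rho(x)v)=\rho(d(x))v+\rho(x)\xi(v)+\lambda\rho(d(x))\xi(v)$. **Differential Lie coalgebra of weight $\lambda$** $(L,\delta,D)$: a Lie coalgebra $(L,\delta)$ with a linear map $D$ such that $\delta D=(D\otimes\mathrm{id})\delta+(\mathrm{id}\otimes D)\delta+\lambda(D\otimes D)\delta$. **Duals.** $\langle f^*(a^* ),x\rangle=\langle a^*,f(x)\rangle$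 for linear maps $f$; $\langle[a^*,b^*]_*,x\rangle=\langle a^*\otimes b^*,\delta(x)\rangle$, and $\delta^*=[-,-]_*$; $\mathrm{ad}^*:L\to\mathfrak{gl}(L^* )$ is $\langle\mathrm{ad}^*(x)b^*,y\rangle=-\langle b^*,[x,y]\rangle$; $\mathfrak{ad}^*:L^*\to\mathfrak{gl}(L)$ is $\langle\mathfrak{ad}^*(a^* )x,b^*\rangle=-\langle x,[a^*,b^*]_*\rangle$. **Adjoint-admissible.** A linear map $\pi:L\to L$ is adjoint-admissible to $(L,[-,-],d)$ if $(L^*,\mathrm{ad}^*,\pi^* )$ is a representation of $(L,[-,-],d)$, i.e. $[x,\pi(y)]=[d(x),y]+\pi([x,y])+\lambda\pi([d(x),y])$ for all $x,y\in L$. **Lie bialgebra** $(L,[-,-],\delta)$: a Lie algebra and Lie coalgebra with $\delta([x,y])=(\mathrm{ad}_x\otimes\mathrm{id}+\mathrm{id}\otimes\mathrm{ad}_x)\delta(y)-(\mathrm{ad}_y\otimes\mathrm{id}+\mathrm{id}\otimes\mathrm{ad}_y)\delta(x)$, where $\mathrm{ad}_x(y)=[x,y]$. **Differential Lie bialgebra** $(L,[-,-],d,\delta,D)$: $(L,[-,-],\delta)$ is a Lie bialgebra; $(L,[-,-],d)$ is a differential Lie algebra of weight $\lambda$; $(L,\delta,D)$ is a differential Lie coalgebra of weight $\lambda$; $D$ is adjoint-admissible to $(L,[-,-],d)$; and $d^*$ is adjoint-admissible to $(L^*,\delta^*,D^* )$. **Bracket on $L\oplus L^*$:** $[x+a^*,y+b^*]_{\oplus}^{\circ}=[x,y]+\mathfrak{ad}^*(a^*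 )y-\mathfrak{ad}^*(b^* )x+[a^*,b^*]_*+\mathrm{ad}^*(x)b^*-\mathrm{ad}^*(y)a^*$, and $(d+D^* )(x+a^* )=d(x)+D^*(a^* )$. **Manin triple of differential Lie algebras** $\big((L\oplus L^*,[-,-]_\oplus^\circ,d+D^* ),L,L^*\big)$: $(L\oplus L^*,[-,-]_\oplus^\circ,d+D^* )$ is a differential Lie algebra of weight $\lambda$ with $(L,[-,-],d)$ and $(L^*,[-,-]_*,D^* )$ as differential Lie subalgebras, and the nondegenerate symmetric bilinear form $\mathcal B(x+a^*,y+b^* )=\langle x,b^*\rangle+\langle a^*,y\rangle$ is invariant, i.e. $\mathcal B([u,v],w)=\mathcal B(u,[v,w])$. **Matched pair.** $(L,V,h,\rho)$, with $\rho:L\to\mathfrak{gl}(V)$ and $h:V\to\mathfrak{gl}(L)$ linear, is a matched pair of Lie algebras $(L,[-,-])$ and $(V,[-,-]_V)$ if $(V,\rho)$ is a representation of $L$, $(L,h)$ is a representation of $V$, and for all $x,y,z\in L$, $a,b,c\in V$: $$[y,h(c)x]-[x,h(c)y]-h(\rho(y)c)(x)+h(\rho(x)c)(y)+h(c)([x,y])=0,$$ $$[b,\rho(z)a]_V-[a,\rho(z)b]_V-\rho(h(b)z)(a)+\rho(h(a)z)(b)+\rho(z)([a,b]_V)=0.$$ A matched pair of differential Lie algebras $(L,[-,-],d)$ and $(V,[-,-]_V,\xi)$ is $(L,V,d,\xi,h,\rho)$ such that $(L,V,h,\rho)$ is a matched pair of Lie algebras, $(V,\rho,\xi)$ is a representation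 of $(L,[-,-],d)$, and $(L,h,d)$ is a representation of $(V,[-,-]_V,\xi)$. In (3), $V=L^*$, $\xi=D^*$, $h=\mathfrak{ad}^*$, $\rho=\mathrm{ad}^*$. *)

theory Defs
  imports Complex_Main "HOL-Library.Function_Algebras" "HOL-Library.Product_Plus"
begin

section \<open>Vector spaces with carriers\<close>

text \<open>
  The dual of a space and the tensor product of two spaces depend on the scalar multiplication,
  so they cannot be types.  A vector space is therefore a subspace \<open>carr V\<close> of an ambient
  vector space given by a type and a scalar multiplication; the addition is that of the type.
  All conditions are imposed on the carriers only.
\<close>

record ('k, 'v) vspace =
  carr :: "'v set"
  smul :: "'k \<Rightarrow> 'v \<Rightarrow> 'v"

definition is_vspace :: "('k::field, 'v::ab_group_add) vspace \<Rightarrow> bool" where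
  "is_vspace V \<longleftrightarrow> vector_space (smul V) \<and> module.subspace (smul V) (carr V)"

definition fin_dim :: "('k::field, 'v::ab_group_add) vspace \<Rightarrow> bool" where
  "fin_dim V \<longleftrightarrow> (\<exists>B. finite B \<and> carr V = module.span (smul V) B)"

definition lin ::
  "('k::field, 'v::ab_group_add) vspace \<Rightarrow> ('k, 'w::ab_group_add) vspace \<Rightarrow> ('v \<Rightarrow> 'w) \<Rightarrow> bool" where
  "lin V W f \<longleftrightarrow> (\<forall>x\<in>carr V. f x \<in> carr W)
     \<and> (\<forall>x\<in>carr V. \<forall>y\<in>carr V. f (x + y) = f x + f y)
     \<and> (\<forall>c. \<forall>x\<in>carr V. f (smul V c x) = smul W c (f x))"

definition bilin ::
  "('k::field, 'v::ab_group_add) vspace \<Rightarrow> ('k, 'w::ab_group_add) vspace \<Rightarrow>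
   ('k, 'u::ab_group_add) vspace \<Rightarrow> ('v \<Rightarrow> 'w \<Rightarrow> 'u) \<Rightarrow> bool" where
  "bilin V W U \<beta> \<longleftrightarrow> (\<forall>x\<in>carr V. lin W U (\<beta> x)) \<and> (\<forall>y\<in>carr W. lin V U (\<lambda>x. \<beta> x y))"

definition scalars :: "('k::field, 'k) vspace" where
  "scalars = \<lparr>carr = UNIV, smul = (*)\<rparr>"

definition fsmul :: "'k::field \<Rightarrow> ('a \<Rightarrow> 'k) \<Rightarrow> 'a \<Rightarrow> 'k" where
  "fsmul c f = (\<lambda>x. c * f x)"

text \<open>
  Functionals are normalised to be zero outside the carrier, so that two of them are equal
  as soon as they agree on the carrier.
\<close>

definition dual :: "('k::field, 'v::ab_group_add) vspace \<Rightarrow> ('k, 'v \<Rightarrow> 'k) vspace" where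
  "dual V = \<lparr>carr = {f. lin V scalars f \<and> (\<forall>x. x \<notin> carr V \<longrightarrow> f x = 0)}, smul = fsmul\<rparr>"

definition dual_map ::
  "('k::field, 'v::ab_group_add) vspace \<Rightarrow> ('v \<Rightarrow> 'w) \<Rightarrow> ('w \<Rightarrow> 'k) \<Rightarrow> 'v \<Rightarrow> 'k" where
  "dual_map V f a = (\<lambda>x. if x \<in> carr V then a (f x) else 0)"

definition dsum ::
  "('k::field, 'v::ab_group_add) vspace \<Rightarrow> ('k, 'w::ab_group_add) vspace \<Rightarrow> ('k, 'v \<times> 'w) vspace" where
  "dsum V W = \<lparr>carr = carr V \<times> carr W, smul = (\<lambda>c p. (smul V c (fst p), smul W c (snd p)))\<rparr>"


section \<open>Tensor products\<close>

text \<open>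
  \<open>V \<otimes> W\<close> is realised as the span of the pure tensors \<open>x \<otimes> y\<close>, where \<open>x \<otimes> y\<close> is the bilinear
  form \<open>(f, g) \<mapsto> f x * g y\<close> on the duals.  Theorem \<open>tensor_universal\<close> shows that this is a tensor
  product; every map out of a tensor product below is defined from its values on pure tensors by
  means of \<open>tensor_lift\<close>, and so does not depend on the realisation.
\<close>

definition pure ::
  "('k::field, 'v::ab_group_add) vspace \<Rightarrow> ('k, 'w::ab_group_add) vspace \<Rightarrow> 'v \<Rightarrow> 'w \<Rightarrow>
   ('v \<Rightarrow> 'k) \<times> ('w \<Rightarrow> 'k) \<Rightarrow> 'k" where
  "pure V W x y = (\<lambda>(f, g). if f \<in> carr (dual V) \<and> g \<in> carr (dual W) then f x * g y else 0)"

definition tensor ::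
  "('k::field, 'v::ab_group_add) vspace \<Rightarrow> ('k, 'w::ab_group_add) vspace \<Rightarrow>
   ('k, ('v \<Rightarrow> 'k) \<times> ('w \<Rightarrow> 'k) \<Rightarrow> 'k) vspace" where
  "tensor V W = \<lparr>carr = module.span fsmul {pure V W x y | x y. x \<in> carr V \<and> y \<in> carr W},
                 smul = fsmul\<rparr>"

definition tensor_lift ::
  "('k::field, 'v::ab_group_add) vspace \<Rightarrow> ('k, 'w::ab_group_add) vspace \<Rightarrow>
   ('k, 'u::ab_group_add) vspace \<Rightarrow> ('v \<Rightarrow> 'w \<Rightarrow> 'u) \<Rightarrow>
   (('v \<Rightarrow> 'k) \<times> ('w \<Rightarrow> 'k) \<Rightarrow> 'k) \<Rightarrow> 'u" where
  "tensor_lift V W U \<beta> = (THE F. lin (tensor V W) U F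
     \<and> (\<forall>x\<in>carr V. \<forall>y\<in>carr W. F (pure V W x y) = \<beta> x y)
     \<and> (\<forall>t. t \<notin> carr (tensor V W) \<longrightarrow> F t = 0))"

lemma vector_space_fsmul: "vector_space (fsmul :: 'k::field \<Rightarrow> ('a \<Rightarrow> 'k) \<Rightarrow> 'a \<Rightarrow> 'k)"
  by unfold_locales (auto simp: fsmul_def fun_eq_iff algebra_simps)

lemma is_vspace_scalars: "is_vspace (scalars :: ('k::field, 'k) vspace)"
proof -
  interpret vector_space "(*) :: 'k \<Rightarrow> 'k \<Rightarrow> 'k"
    by unfold_locales (auto simp: algebra_simps)
  show ?thesis
    by (simp add: is_vspace_def scalars_def vector_space_axioms)
qed

lemma is_vspace_tensor:
  fixes V :: "('a::field, 'b::ab_group_add) vspace" and W :: "('a, 'c::ab_group_add) vspace"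
  shows "is_vspace (tensor V W)"
proof -
  interpret vector_space "fsmul :: 'a \<Rightarrow> ((('b \<Rightarrow> 'a) \<times> ('c \<Rightarrow> 'a)) \<Rightarrow> 'a) \<Rightarrow> _"
    by (rule vector_space_fsmul)
  show ?thesis
    by (simp add: is_vspace_def tensor_def vector_space_axioms)
qed

lemma pure_in_tensor:
  fixes V :: "('a::field, 'b::ab_group_add) vspace" and W :: "('a, 'c::ab_group_add) vspace"
  assumes "x \<in> carr V" "y \<in> carr W"
  shows "pure V W x y \<in> carr (tensor V W)"
proof -
  interpret vector_space "fsmul :: 'a \<Rightarrow> ((('b \<Rightarrow> 'a) \<times> ('c \<Rightarrow> 'a)) \<Rightarrow> 'a) \<Rightarrow> _"
    by (rule vector_space_fsmul)
  show ?thesis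
    using assms by (auto simp: tensor_def intro!: span_base)
qed

lemma bilin_pure:
  assumes "is_vspace V" "is_vspace W"
  shows "bilin V W (tensor V W) (pure V W)"
  using pure_in_tensor[of _ V _ W]
  by (auto simp: bilin_def lin_def pure_def fun_eq_iff dual_def scalars_def tensor_def fsmul_def
      algebra_simps)

lemma coordinate_functional:
  fixes V :: "('a::field, 'b::ab_group_add) vspace"
  assumes V: "is_vspace V" and B: "B \<subseteq> carr V" "\<not> module.dependent (smul V) B"
    and b: "b \<in> B"
  shows "\<exists>f\<in>carr (dual V). \<forall>b'\<in>B. f b' = (if b' = b then 1 else 0)"
proof -
  interpret vector_space_pair "smul V" "(*) :: 'a \<Rightarrow> 'a \<Rightarrow> 'a"
    using V is_vspace_scalars[where 'k='a] by (simp add: vector_space_pair_def is_vspace_def scalars_def)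
  obtain g where g: "Vector_Spaces.linear (smul V) (*) g" "\<forall>x\<in>B. g x = (if x = b then 1 else 0)"
    using linear_independent_extend[OF B(2), of "\<lambda>x. if x = b then 1 else 0"] by blast
  have sub: "vs1.subspace (carr V)"
    using V by (simp add: is_vspace_def)
  define f where "f x = (if x \<in> carr V then g x else 0)" for x
  have "f \<in> carr (dual V)"
    using g(1) vs1.subspace_add[OF sub] vs1.subspace_scale[OF sub]
    by (auto simp: dual_def lin_def scalars_def f_def Vector_Spaces.linear_iff)
  moreover have "\<forall>b'\<in>B. f b' = (if b' = b then 1 else 0)"
    using g(2) B(1) by (auto simp: f_def)
  ultimately show ?thesis by blast
qed

lemma lin_eq_on_span:
  assumes V: "is_vspace V" and W: "is_vspace W" and f: "lin V W f" and g: "lin V W g"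
    and B: "B \<subseteq> carr V" "\<And>b. b \<in> B \<Longrightarrow> f b = g b" and x: "x \<in> module.span (smul V) B"
  shows "f x = g x"
proof -
  interpret V: vector_space "smul V" using V by (simp add: is_vspace_def)
  interpret W: vector_space "smul W" using W by (simp add: is_vspace_def)
  have sub: "V.subspace (carr V)"
    using V by (simp add: is_vspace_def)
  have z: "f 0 = 0" "g 0 = 0"
    using f g V.subspace_0[OF sub] by (metis lin_def V.scale_zero_left W.scale_zero_left)+
  have "x \<in> carr V \<and> f x = g x"
    using x
  proof (induction rule: V.span_induct_alt)
    case base
    then show ?case using z V.subspace_0[OF sub] by simp
  next
    case (step c b y)
    then have "b \<in> carr V" "smul V c b \<in> carr V"
      using B(1) V.subspace_scale[OF sub] by auto
    then show ?case
      using step B(2) f g V.subspace_add[OF sub] by (auto simp: lin_def)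
  qed
  then show ?thesis ..
qed

theorem tensor_universal:
  fixes V :: "('k::field, 'v::ab_group_add) vspace" and W :: "('k, 'w::ab_group_add) vspace"
    and U :: "('k, 'u::ab_group_add) vspace"
  assumes V: "is_vspace V" and W: "is_vspace W" and U: "is_vspace U" and \<beta>: "bilin V W U \<beta>"
  shows "\<exists>!F. lin (tensor V W) U F
     \<and> (\<forall>x\<in>carr V. \<forall>y\<in>carr W. F (pure V W x y) = \<beta> x y)
     \<and> (\<forall>t. t \<notin> carr (tensor V W) \<longrightarrow> F t = 0)"
proof -
  let ?P = "{pure V W x y | x y. x \<in> carr V \<and> y \<in> carr W}"
  interpret V: vector_space "smul V" using V by (simp add: is_vspace_def)
  interpret W: vector_space "smul W" using W by (simp add: is_vspace_def)
  interpret vector_space_pair "fsmul :: 'k \<Rightarrow> ((('v \<Rightarrow> 'k) \<times> ('w \<Rightarrow> 'k)) \<Rightarrow> 'k) \<Rightarrow> _" "smul U"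
    using U vector_space_fsmul by (simp add: vector_space_pair_def is_vspace_def)
  have subU: "vs2.subspace (carr U)"
    using U by (simp add: is_vspace_def)
  have T: "is_vspace (tensor V W)" by (rule is_vspace_tensor)
  have pure_V: "lin V (tensor V W) (\<lambda>x. pure V W x y)" if "y \<in> carr W" for y
    using bilin_pure[OF V W] that by (simp add: bilin_def)
  have pure_W: "lin W (tensor V W) (pure V W x)" if "x \<in> carr V" for x
    using bilin_pure[OF V W] that by (simp add: bilin_def)

  obtain B where B: "B \<subseteq> carr V" "V.independent B" "carr V \<subseteq> V.span B"
    using V.maximal_independent_subset by blast
  obtain C where C: "C \<subseteq> carr W" "W.independent C" "carr W \<subseteq> W.span C"
    using W.maximal_independent_subset by blast
  define S where "S = (\<lambda>(b, c). pure V W b c) ` (B \<times> C)"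
  have sep: "\<exists>e. e (pure V W b c) \<noteq> 0 \<and> (\<forall>b'\<in>B. \<forall>c'\<in>C. (b', c') \<noteq> (b, c) \<longrightarrow> e (pure V W b' c') = 0)
      \<and> Vector_Spaces.linear fsmul (*) e" if bc: "b \<in> B" "c \<in> C" for b c
  proof -
    obtain f where f: "f \<in> carr (dual V)" "\<forall>b'\<in>B. f b' = (if b' = b then 1 else 0)"
      using coordinate_functional[OF V B(1,2) bc(1)] by blast
    obtain g where g: "g \<in> carr (dual W)" "\<forall>c'\<in>C. g c' = (if c' = c then 1 else 0)"
      using coordinate_functional[OF W C(1,2) bc(2)] by blast
    have "Vector_Spaces.linear fsmul (*) (\<lambda>t. t (f, g) :: 'k)"
      using vector_space_fsmul is_vspace_scalars[where 'k='k]
      by (auto simp: Vector_Spaces.linear_iff fsmul_def is_vspace_def scalars_def)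
    then show ?thesis
      using f g bc by (intro exI[of _ "\<lambda>t. t (f, g)"]) (auto simp: pure_def)
  qed
  have inj: "inj_on (\<lambda>(b, c). pure V W b c) (B \<times> C)"
  proof (rule inj_onI, clarify)
    fix b c b' c'
    assume "b \<in> B" "c \<in> C" "b' \<in> B" "c' \<in> C" "pure V W b c = pure V W b' c'"
    then show "b = b' \<and> c = c'" using sep[of b c] by fastforce
  qed
  have indep: "vs1.independent S"
    unfolding vs1.dependent_def
  proof clarify
    fix s assume "s \<in> S" and s: "s \<in> vs1.span (S - {s})"
    then obtain b c where bc: "b \<in> B" "c \<in> C" "s = pure V W b c" by (auto simp: S_def)
    obtain e where e: "e s \<noteq> 0" "Vector_Spaces.linear fsmul (*) e"
      "\<forall>b'\<in>B. \<forall>c'\<in>C. (b', c') \<noteq> (b, c) \<longrightarrow> e (pure V W b' c') = 0"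
      using sep[OF bc(1,2)] bc(3) by blast
    interpret e: Vector_Spaces.linear fsmul "(*)" e by (rule e(2))
    have "e x = 0" if "x \<in> S - {s}" for x
      using that e(3) bc by (auto simp: S_def)
    then have "e s = 0" using e.eq_0_on_span s by blast
    with e(1) show False by simp
  qed
  obtain G where G: "Vector_Spaces.linear fsmul (smul U) G"
    "\<forall>s\<in>S. G s = (\<lambda>(b, c). \<beta> b c) (the_inv_into (B \<times> C) (\<lambda>(b, c). pure V W b c) s)"
    using linear_independent_extend[OF indep,
        of "\<lambda>s. (\<lambda>(b, c). \<beta> b c) (the_inv_into (B \<times> C) (\<lambda>(b, c). pure V W b c) s)"]
    by blast
  interpret G: Vector_Spaces.linear fsmul "smul U" G by (rule G(1))
  let ?U = "\<lparr>carr = UNIV, smul = smul U\<rparr>"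
  have U': "is_vspace ?U"
    using vs2.vector_space_axioms by (simp add: is_vspace_def)
  have G_bc: "G (pure V W b c) = \<beta> b c" if "b \<in> B" "c \<in> C" for b c
    using G(2) that the_inv_into_f_f[OF inj, of "(b, c)"] by (auto simp: S_def)
  have G_V: "lin V ?U (\<lambda>x. G (pure V W x y))" if "y \<in> carr W" for y
    using pure_V[OF that] by (auto simp: lin_def G.add G.scale tensor_def)
  have G_W: "lin W ?U (\<lambda>y. G (pure V W x y))" if "x \<in> carr V" for x
    using pure_W[OF that] by (auto simp: lin_def G.add G.scale tensor_def)
  have \<beta>_V: "lin V ?U (\<lambda>x. \<beta> x y)" if "y \<in> carr W" for y
    using \<beta> that by (auto simp: bilin_def lin_def)
  have \<beta>_W: "lin W ?U (\<beta> x)" if "x \<in> carr V" for x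
    using \<beta> that by (auto simp: bilin_def lin_def)
  have G_by: "G (pure V W b y) = \<beta> b y" if "b \<in> B" "y \<in> carr W" for b y
    using lin_eq_on_span[OF W U' G_W \<beta>_W C(1), of b b y] G_bc that B(1) C(3) by blast
  have G_xy: "G (pure V W x y) = \<beta> x y" if "x \<in> carr V" "y \<in> carr W" for x y
    using lin_eq_on_span[OF V U' G_V \<beta>_V B(1), of y y x] G_by that B(3) by blast
  have G_U: "G t \<in> carr U" if "t \<in> carr (tensor V W)" for t
  proof -
    have "t \<in> vs1.span ?P" using that by (simp add: tensor_def)
    then show ?thesis
    proof (induction rule: vs1.span_induct_alt)
      case base
      then show ?case unfolding G.zero by (rule vs2.subspace_0[OF subU])
    next
      case (step c x y)
      then obtain v w where "x = pure V W v w" "v \<in> carr V" "w \<in> carr W" by blast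
      then have "G x \<in> carr U" using G_xy \<beta> by (auto simp: bilin_def lin_def)
      then show ?case
        unfolding G.add G.scale
        using step by (intro vs2.subspace_add[OF subU] vs2.subspace_scale[OF subU])
    qed
  qed
  have subT: "vs1.subspace (carr (tensor V W))"
    using T by (simp add: is_vspace_def tensor_def)
  show ?thesis
  proof (rule ex_ex1I)
    define F where "F t = (if t \<in> carr (tensor V W) then G t else 0)" for t
    have "lin (tensor V W) U F"
      unfolding lin_def
    proof (intro conjI ballI allI)
      fix t t' c assume t: "t \<in> carr (tensor V W)"
      then show "F t \<in> carr U" using G_U by (simp only: F_def if_True)
      have "fsmul c t \<in> carr (tensor V W)" using t vs1.subspace_scale[OF subT] by blast
      moreover have "smul (tensor V W) c t = fsmul c t" by (simp add: tensor_def)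
      ultimately show "F (smul (tensor V W) c t) = smul U c (F t)"
        using t by (simp only: F_def if_True G.scale)
      assume t': "t' \<in> carr (tensor V W)"
      then have "t + t' \<in> carr (tensor V W)" using t vs1.subspace_add[OF subT] by blast
      then show "F (t + t') = F t + F t'" using t t' by (simp only: F_def if_True G.add)
    qed
    moreover have "\<forall>x\<in>carr V. \<forall>y\<in>carr W. F (pure V W x y) = \<beta> x y"
      using G_xy pure_in_tensor[of _ V _ W] by (simp add: F_def)
    ultimately show "\<exists>F. lin (tensor V W) U F
        \<and> (\<forall>x\<in>carr V. \<forall>y\<in>carr W. F (pure V W x y) = \<beta> x y)
        \<and> (\<forall>t. t \<notin> carr (tensor V W) \<longrightarrow> F t = 0)"
      by (auto simp: F_def)
  next
    fix F F'
    assume F: "lin (tensor V W) U F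
        \<and> (\<forall>x\<in>carr V. \<forall>y\<in>carr W. F (pure V W x y) = \<beta> x y)
        \<and> (\<forall>t. t \<notin> carr (tensor V W) \<longrightarrow> F t = 0)"
      and F': "lin (tensor V W) U F'
        \<and> (\<forall>x\<in>carr V. \<forall>y\<in>carr W. F' (pure V W x y) = \<beta> x y)
        \<and> (\<forall>t. t \<notin> carr (tensor V W) \<longrightarrow> F' t = 0)"
    show "F = F'"
    proof
      fix t
      show "F t = F' t"
      proof (cases "t \<in> carr (tensor V W)")
        case True
        have "?P \<subseteq> carr (tensor V W)" using pure_in_tensor[of _ V _ W] by blast
        moreover have "t \<in> module.span (smul (tensor V W)) ?P"
          using True by (simp add: tensor_def)
        ultimately show ?thesis
          using lin_eq_on_span[OF T U, of F F' ?P t] F F' by fastforce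
      qed (use F F' in simp)
    qed
  qed
qed

lemma tensor_lift:
  assumes "is_vspace V" "is_vspace W" "is_vspace U" "bilin V W U \<beta>"
  shows "lin (tensor V W) U (tensor_lift V W U \<beta>)"
    and "\<lbrakk>x \<in> carr V; y \<in> carr W\<rbrakk> \<Longrightarrow> tensor_lift V W U \<beta> (pure V W x y) = \<beta> x y"
  using theI'[OF tensor_universal[OF assms]] by (auto simp: tensor_lift_def)

definition tensor_map ::
  "('k::field, 'v::ab_group_add) vspace \<Rightarrow> ('k, 'w::ab_group_add) vspace \<Rightarrow>
   ('k, 'v'::ab_group_add) vspace \<Rightarrow> ('k, 'w'::ab_group_add) vspace \<Rightarrow>
   ('v \<Rightarrow> 'v') \<Rightarrow> ('w \<Rightarrow> 'w') \<Rightarrow>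
   (('v \<Rightarrow> 'k) \<times> ('w \<Rightarrow> 'k) \<Rightarrow> 'k) \<Rightarrow> (('v' \<Rightarrow> 'k) \<times> ('w' \<Rightarrow> 'k) \<Rightarrow> 'k)" where
  "tensor_map V W V' W' f g = tensor_lift V W (tensor V' W') (\<lambda>x y. pure V' W' (f x) (g y))"

definition tensor_pairing ::
  "('k::field, 'v::ab_group_add) vspace \<Rightarrow> ('v \<Rightarrow> 'k) \<Rightarrow> ('v \<Rightarrow> 'k) \<Rightarrow>
   (('v \<Rightarrow> 'k) \<times> ('v \<Rightarrow> 'k) \<Rightarrow> 'k) \<Rightarrow> 'k" where
  "tensor_pairing V a b = tensor_lift V V scalars (\<lambda>x y. a x * b y)"

definition flip ::
  "('k::field, 'v::ab_group_add) vspace \<Rightarrow>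
   (('v \<Rightarrow> 'k) \<times> ('v \<Rightarrow> 'k) \<Rightarrow> 'k) \<Rightarrow> (('v \<Rightarrow> 'k) \<times> ('v \<Rightarrow> 'k) \<Rightarrow> 'k)" where
  "flip V = tensor_lift V V (tensor V V) (\<lambda>x y. pure V V y x)"

text \<open>The cyclic permutation \<open>x \<otimes> (y \<otimes> z) \<mapsto> y \<otimes> (z \<otimes> x)\<close> of \<open>V \<otimes> (V \<otimes> V)\<close>:\<close>

definition cyc ::
  "('k::field, 'v::ab_group_add) vspace \<Rightarrow>
   (('v \<Rightarrow> 'k) \<times> ((('v \<Rightarrow> 'k) \<times> ('v \<Rightarrow> 'k) \<Rightarrow> 'k) \<Rightarrow> 'k) \<Rightarrow> 'k) \<Rightarrow>
   (('v \<Rightarrow> 'k) \<times> ((('v \<Rightarrow> 'k) \<times> ('v \<Rightarrow> 'k) \<Rightarrow> 'k) \<Rightarrow> 'k) \<Rightarrow> 'k)" where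
  "cyc V = tensor_lift V (tensor V V) (tensor V (tensor V V))
     (\<lambda>x. tensor_lift V V (tensor V (tensor V V))
        (\<lambda>y z. pure V (tensor V V) y (pure V V z x)))"


section \<open>Differential Lie algebras and their representations\<close>

definition lie_algebra ::
  "('k::field, 'v::ab_group_add) vspace \<Rightarrow> ('v \<Rightarrow> 'v \<Rightarrow> 'v) \<Rightarrow> bool" where
  "lie_algebra L br \<longleftrightarrow> is_vspace L \<and> bilin L L L br
     \<and> (\<forall>x\<in>carr L. br x x = 0)
     \<and> (\<forall>x\<in>carr L. \<forall>y\<in>carr L. \<forall>z\<in>carr L.
          br x (br y z) + br y (br z x) + br z (br x y) = 0)"

definition diff_lie_algebra ::
  "'k::field \<Rightarrow> ('k, 'v::ab_group_add) vspace \<Rightarrow> ('v \<Rightarrow> 'v \<Rightarrow> 'v) \<Rightarrow> ('v \<Rightarrow> 'v) \<Rightarrow> bool" where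
  "diff_lie_algebra lam L br d \<longleftrightarrow> lie_algebra L br \<and> lin L L d
     \<and> (\<forall>x\<in>carr L. \<forall>y\<in>carr L.
          d (br x y) = br (d x) y + br x (d y) + smul L lam (br (d x) (d y)))"

definition lie_rep ::
  "('k::field, 'v::ab_group_add) vspace \<Rightarrow> ('v \<Rightarrow> 'v \<Rightarrow> 'v) \<Rightarrow>
   ('k, 'm::ab_group_add) vspace \<Rightarrow> ('v \<Rightarrow> 'm \<Rightarrow> 'm) \<Rightarrow> bool" where
  "lie_rep L br M \<rho> \<longleftrightarrow> is_vspace M \<and> bilin L M M \<rho>
     \<and> (\<forall>x\<in>carr L. \<forall>y\<in>carr L. \<forall>v\<in>carr M. \<rho> (br x y) v = \<rho> x (\<rho> y v) - \<rho> y (\<rho> x v))"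

definition diff_lie_rep ::
  "'k::field \<Rightarrow> ('k, 'v::ab_group_add) vspace \<Rightarrow> ('v \<Rightarrow> 'v \<Rightarrow> 'v) \<Rightarrow> ('v \<Rightarrow> 'v) \<Rightarrow>
   ('k, 'm::ab_group_add) vspace \<Rightarrow> ('v \<Rightarrow> 'm \<Rightarrow> 'm) \<Rightarrow> ('m \<Rightarrow> 'm) \<Rightarrow> bool" where
  "diff_lie_rep lam L br d M \<rho> \<xi> \<longleftrightarrow> lie_rep L br M \<rho> \<and> lin M M \<xi>
     \<and> (\<forall>x\<in>carr L. \<forall>v\<in>carr M.
          \<xi> (\<rho> x v) = \<rho> (d x) v + \<rho> x (\<xi> v) + smul M lam (\<rho> (d x) (\<xi> v)))"

definition coad ::
  "('k::field, 'v::ab_group_add) vspace \<Rightarrow> ('v \<Rightarrow> 'v \<Rightarrow> 'v) \<Rightarrow> 'v \<Rightarrow> ('v \<Rightarrow> 'k) \<Rightarrow> 'v \<Rightarrow> 'k" where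
  "coad L br x b = (\<lambda>y. if y \<in> carr L then - b (br x y) else 0)"

text \<open>
  The coadjoint action of \<open>L\<^sup>*\<close>, with \<open>L\<^sup>*\<^sup>*\<close> identified with \<open>L\<close>; the element of \<open>L\<close> exists and is
  unique if \<open>L\<close> is finite-dimensional and \<open>brs\<close> is bilinear on \<open>L\<^sup>*\<close>.
\<close>

definition coad_dual ::
  "('k::field, 'v::ab_group_add) vspace \<Rightarrow> (('v \<Rightarrow> 'k) \<Rightarrow> ('v \<Rightarrow> 'k) \<Rightarrow> ('v \<Rightarrow> 'k)) \<Rightarrow>
   ('v \<Rightarrow> 'k) \<Rightarrow> 'v \<Rightarrow> 'v" where
  "coad_dual L brs a x = (THE z. z \<in> carr L \<and> (\<forall>b\<in>carr (dual L). b z = - brs a b x))"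

definition adjoint_admissible ::
  "'k::field \<Rightarrow> ('k, 'v::ab_group_add) vspace \<Rightarrow> ('v \<Rightarrow> 'v \<Rightarrow> 'v) \<Rightarrow> ('v \<Rightarrow> 'v) \<Rightarrow>
   ('v \<Rightarrow> 'v) \<Rightarrow> bool" where
  "adjoint_admissible lam L br d \<pi> \<longleftrightarrow> lin L L \<pi>
     \<and> diff_lie_rep lam L br d (dual L) (coad L br) (dual_map L \<pi>)"

lemma is_vspace_dual:
  fixes V :: "('k::field, 'v::ab_group_add) vspace"
  assumes "is_vspace V"
  shows "is_vspace (dual V)"
proof -
  interpret vector_space "fsmul :: 'k \<Rightarrow> ('v \<Rightarrow> 'k) \<Rightarrow> _" by (rule vector_space_fsmul)
  show ?thesis
    by (auto simp: is_vspace_def dual_def vector_space_axioms subspace_def lin_def scalars_def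
        fsmul_def algebra_simps)
qed

lemma dual_separates:
  assumes V: "is_vspace V" and x: "x \<in> carr V" "\<forall>b\<in>carr (dual V). b x = 0"
  shows "x = 0"
proof (rule ccontr)
  assume "x \<noteq> 0"
  interpret vector_space "smul V" using V by (simp add: is_vspace_def)
  have "independent {x}" using \<open>x \<noteq> 0\<close> by simp
  then show False
    using coordinate_functional[OF V, of "{x}" x] x by auto
qed

lemma adjoint_admissible_iff:
  assumes L: "diff_lie_algebra lam L br d" and \<pi>: "lin L L \<pi>"
  shows "adjoint_admissible lam L br d \<pi> \<longleftrightarrow> (\<forall>x\<in>carr L. \<forall>y\<in>carr L.
           br x (\<pi> y) = br (d x) y + \<pi> (br x y) + smul L lam (\<pi> (br (d x) y)))"
    (is "_ \<longleftrightarrow> (\<forall>x\<in>carr L. \<forall>y\<in>carr L. ?l x y = ?r x y)")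
proof -
  have vL: "is_vspace L" and br: "bilin L L L br" and d: "lin L L d"
    using L by (auto simp: diff_lie_algebra_def lie_algebra_def)
  interpret vector_space "smul L" using vL by (simp add: is_vspace_def)
  have sub: "subspace (carr L)" using vL by (simp add: is_vspace_def)
  note closed = subspace_add[OF sub] subspace_scale[OF sub] subspace_diff[OF sub] subspace_neg[OF sub]
  have br_in: "br x y \<in> carr L" if "x \<in> carr L" "y \<in> carr L" for x y
    using br that by (auto simp: bilin_def lin_def)
  have d_in: "d x \<in> carr L" "\<pi> x \<in> carr L" if "x \<in> carr L" for x
    using d \<pi> that by (auto simp: lin_def)
  have br_lin: "br (x + x') y = br x y + br x' y" "br y (x + x') = br y x + br y x'"
    "br (smul L c x) y = smul L c (br x y)" "br y (smul L c x) = smul L c (br y x)"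
    if "x \<in> carr L" "x' \<in> carr L" "y \<in> carr L" for x x' y c
    using br that by (auto simp: bilin_def lin_def)
  have anti: "br x y = - br y x" if "x \<in> carr L" "y \<in> carr L" for x y
  proof -
    have "br (x + y) (x + y) = 0" "br x x = 0" "br y y = 0"
      using L that closed by (auto simp: diff_lie_algebra_def lie_algebra_def)
    then show ?thesis
      using that closed by (simp add: br_lin eq_neg_iff_add_eq_0 add.commute)
  qed
  have b_lin: "b (x + y) = b x + b y" "b (smul L c x) = c * b x"
    if "b \<in> carr (dual L)" "x \<in> carr L" "y \<in> carr L" for b x y c
    using that by (auto simp: dual_def lin_def scalars_def)
  have b_0: "b x = 0" if "b \<in> carr (dual L)" "x \<notin> carr L" for b x
    using that by (auto simp: dual_def)
  have b_neg: "b (- x) = - b x" if "b \<in> carr (dual L)" "x \<in> carr L" for b x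
    using b_lin(2)[OF that(1) that(2) that(2), of "-1"] by simp
  have b_diff: "b (x - y) = b x - b y"
    if "b \<in> carr (dual L)" "x \<in> carr L" "y \<in> carr L" for b x y
    using b_lin(1)[of b x "- y"] b_neg[of b y] that closed by simp
  have jac: "br (br x y) z = br x (br y z) - br y (br x z)"
    if "x \<in> carr L" "y \<in> carr L" "z \<in> carr L" for x y z
  proof -
    have "br x (br y z) + br y (br z x) + br z (br x y) = 0"
      using L that by (auto simp: diff_lie_algebra_def lie_algebra_def)
    moreover have "br z (br x y) = - br (br x y) z" using anti br_in that by blast
    moreover have "br y (br z x) = - br y (br x z)"
    proof -
      have "br z x = smul L (-1) (br x z)" using anti[of z x] that by simp
      then show ?thesis using br_lin(4)[of "br x z" "br x z" y "-1"] br_in that by simp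
    qed
    ultimately show ?thesis by (simp add: algebra_simps)
  qed
  have coad_in: "coad L br x b \<in> carr (dual L)" if "x \<in> carr L" "b \<in> carr (dual L)" for x b
    using that closed br_in
    by (auto simp: coad_def dual_def lin_def scalars_def br_lin)
  have rep: "lie_rep L br (dual L) (coad L br)"
    unfolding lie_rep_def bilin_def
  proof (intro conjI ballI)
    fix x y b assume "x \<in> carr L" "y \<in> carr L" "b \<in> carr (dual L)"
    then show "coad L br (br x y) b
        = coad L br x (coad L br y b) - coad L br y (coad L br x b)"
      using br_in by (auto simp: coad_def fun_eq_iff jac b_diff)
  next
    fix x assume "x \<in> carr L"
    then show "lin (dual L) (dual L) (coad L br x)"
      unfolding lin_def using coad_in by (auto simp: coad_def fun_eq_iff dual_def fsmul_def)
  next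
    fix b assume "b \<in> carr (dual L)"
    then show "lin L (dual L) (\<lambda>x. coad L br x b)"
      unfolding lin_def using coad_in br_in
      by (auto simp: coad_def fun_eq_iff br_lin b_lin) (auto simp: dual_def fsmul_def coad_def br_lin lin_def scalars_def)
  qed (rule is_vspace_dual[OF vL])
  have pi_in: "dual_map L \<pi> b \<in> carr (dual L)" if "b \<in> carr (dual L)" for b
    using that \<pi> closed by (auto simp: dual_map_def dual_def lin_def scalars_def)
  have pi_lin: "lin (dual L) (dual L) (dual_map L \<pi>)"
    unfolding lin_def using pi_in by (auto simp: dual_map_def fun_eq_iff dual_def fsmul_def)
  have eq: "(dual_map L \<pi> (coad L br x b) = coad L br (d x) b + coad L br x (dual_map L \<pi> b)
       + smul (dual L) lam (coad L br (d x) (dual_map L \<pi> b)))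
     \<longleftrightarrow> (\<forall>y\<in>carr L. b (?l x y) = b (?r x y))"
    if x: "x \<in> carr L" and b: "b \<in> carr (dual L)" for x b
  proof -
    have r: "b (?r x y) = b (br (d x) y) + b (\<pi> (br x y)) + lam * b (\<pi> (br (d x) y))"
      if "y \<in> carr L" for y
      using that x b closed br_in d_in by (simp add: b_lin)
    have "(- p = - q - r - s) = (p = q + r + s)" for p q r s :: 'a
      by (metis (no_types) add.inverse_inverse diff_conv_add_uminus minus_add_distrib)
    then show ?thesis
      using x b br_in d_in
      by (auto simp: fun_eq_iff dual_map_def coad_def dual_def fsmul_def r[unfolded dual_def])
  qed
  have "adjoint_admissible lam L br d \<pi> \<longleftrightarrow>
      (\<forall>x\<in>carr L. \<forall>b\<in>carr (dual L). \<forall>y\<in>carr L. b (?l x y) = b (?r x y))"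
    using rep pi_lin \<pi> eq by (simp add: adjoint_admissible_def diff_lie_rep_def)
  also have "\<dots> \<longleftrightarrow> (\<forall>x\<in>carr L. \<forall>y\<in>carr L. ?l x y = ?r x y)"
  proof (intro iffI ballI)
    fix x y
    assume h: "\<forall>x\<in>carr L. \<forall>b\<in>carr (dual L). \<forall>y\<in>carr L. b (?l x y) = b (?r x y)"
      and xy: "x \<in> carr L" "y \<in> carr L"
    have in_L: "?l x y \<in> carr L" "?r x y \<in> carr L"
      using xy closed br_in d_in by auto
    have "?l x y - ?r x y = 0"
    proof (rule dual_separates[OF vL])
      show "?l x y - ?r x y \<in> carr L" using in_L closed by blast
      show "\<forall>b\<in>carr (dual L). b (?l x y - ?r x y) = 0"
        using h xy in_L b_diff by fastforce
    qed
    then show "?l x y = ?r x y" by simp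
  qed simp
  finally show ?thesis .
qed


section \<open>Differential Lie coalgebras and bialgebras\<close>

text \<open>
  The condition \<open>\<delta> x \<in> Im (id - flip)\<close> is the dual of \<open>[a, a] = 0\<close> in every characteristic;
  outside characteristic 2 it says that \<open>\<delta> x\<close> is antisymmetric.
\<close>

definition lie_coalgebra ::
  "('k::field, 'v::ab_group_add) vspace \<Rightarrow>
   ('v \<Rightarrow> (('v \<Rightarrow> 'k) \<times> ('v \<Rightarrow> 'k) \<Rightarrow> 'k)) \<Rightarrow> bool" where
  "lie_coalgebra L \<delta> \<longleftrightarrow> is_vspace L \<and> lin L (tensor L L) \<delta>
     \<and> (\<forall>x\<in>carr L. \<exists>t\<in>carr (tensor L L). \<delta> x = t - flip L t)
     \<and> (\<forall>x\<in>carr L. let t = tensor_map L L L (tensor L L) id \<delta> (\<delta> x)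
          in t + cyc L t + cyc L (cyc L t) = 0)"

definition diff_lie_coalgebra ::
  "'k::field \<Rightarrow> ('k, 'v::ab_group_add) vspace \<Rightarrow>
   ('v \<Rightarrow> (('v \<Rightarrow> 'k) \<times> ('v \<Rightarrow> 'k) \<Rightarrow> 'k)) \<Rightarrow> ('v \<Rightarrow> 'v) \<Rightarrow> bool" where
  "diff_lie_coalgebra lam L \<delta> D \<longleftrightarrow> lie_coalgebra L \<delta> \<and> lin L L D
     \<and> (\<forall>x\<in>carr L. \<delta> (D x) = tensor_map L L L L D id (\<delta> x) + tensor_map L L L L id D (\<delta> x)
          + smul (tensor L L) lam (tensor_map L L L L D D (\<delta> x)))"

definition dual_bracket ::
  "('k::field, 'v::ab_group_add) vspace \<Rightarrow> ('v \<Rightarrow> (('v \<Rightarrow> 'k) \<times> ('v \<Rightarrow> 'k) \<Rightarrow> 'k)) \<Rightarrow>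
   ('v \<Rightarrow> 'k) \<Rightarrow> ('v \<Rightarrow> 'k) \<Rightarrow> ('v \<Rightarrow> 'k)" where
  "dual_bracket L \<delta> a b = (\<lambda>x. if x \<in> carr L then tensor_pairing L a b (\<delta> x) else 0)"

definition lie_bialgebra ::
  "('k::field, 'v::ab_group_add) vspace \<Rightarrow> ('v \<Rightarrow> 'v \<Rightarrow> 'v) \<Rightarrow>
   ('v \<Rightarrow> (('v \<Rightarrow> 'k) \<times> ('v \<Rightarrow> 'k) \<Rightarrow> 'k)) \<Rightarrow> bool" where
  "lie_bialgebra L br \<delta> \<longleftrightarrow> lie_algebra L br \<and> lie_coalgebra L \<delta>
     \<and> (\<forall>x\<in>carr L. \<forall>y\<in>carr L.
          \<delta> (br x y) =
            (tensor_map L L L L (br x) id (\<delta> y) + tensor_map L L L L id (br x) (\<delta> y))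
          - (tensor_map L L L L (br y) id (\<delta> x) + tensor_map L L L L id (br y) (\<delta> x)))"

definition diff_lie_bialgebra ::
  "'k::field \<Rightarrow> ('k, 'v::ab_group_add) vspace \<Rightarrow> ('v \<Rightarrow> 'v \<Rightarrow> 'v) \<Rightarrow> ('v \<Rightarrow> 'v) \<Rightarrow>
   ('v \<Rightarrow> (('v \<Rightarrow> 'k) \<times> ('v \<Rightarrow> 'k) \<Rightarrow> 'k)) \<Rightarrow> ('v \<Rightarrow> 'v) \<Rightarrow> bool" where
  "diff_lie_bialgebra lam L br d \<delta> D \<longleftrightarrow> lie_bialgebra L br \<delta>
     \<and> diff_lie_algebra lam L br d
     \<and> diff_lie_coalgebra lam L \<delta> D
     \<and> adjoint_admissible lam L br d D
     \<and> adjoint_admissible lam (dual L) (dual_bracket L \<delta>) (dual_map L D) (dual_map L d)"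


section \<open>Manin triples and matched pairs\<close>

definition double_bracket ::
  "('k::field, 'v::ab_group_add) vspace \<Rightarrow> ('v \<Rightarrow> 'v \<Rightarrow> 'v) \<Rightarrow>
   (('v \<Rightarrow> 'k) \<Rightarrow> ('v \<Rightarrow> 'k) \<Rightarrow> ('v \<Rightarrow> 'k)) \<Rightarrow>
   'v \<times> ('v \<Rightarrow> 'k) \<Rightarrow> 'v \<times> ('v \<Rightarrow> 'k) \<Rightarrow> 'v \<times> ('v \<Rightarrow> 'k)" where
  "double_bracket L br brs = (\<lambda>(x, a) (y, b).
     (br x y + coad_dual L brs a y - coad_dual L brs b x,
      brs a b + coad L br x b - coad L br y a))"

definition double_form :: "'v \<times> ('v \<Rightarrow> 'k) \<Rightarrow> 'v \<times> ('v \<Rightarrow> 'k) \<Rightarrow> 'k::field" where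
  "double_form = (\<lambda>(x, a) (y, b). b x + a y)"

definition nondegenerate_symmetric ::
  "('k::field, 'v::ab_group_add) vspace \<Rightarrow> ('v \<Rightarrow> 'v \<Rightarrow> 'k) \<Rightarrow> bool" where
  "nondegenerate_symmetric M B \<longleftrightarrow> bilin M M scalars B
     \<and> (\<forall>u\<in>carr M. \<forall>v\<in>carr M. B u v = B v u)
     \<and> (\<forall>u\<in>carr M. (\<forall>v\<in>carr M. B u v = 0) \<longrightarrow> u = 0)"

text \<open>\<open>A\<close> is regarded as a subspace of \<open>M\<close> by means of the injection \<open>\<iota>\<close>.\<close>

definition diff_lie_subalgebra ::
  "'k::field \<Rightarrow> ('k, 'v::ab_group_add) vspace \<Rightarrow> ('v \<Rightarrow> 'v \<Rightarrow> 'v) \<Rightarrow> ('v \<Rightarrow> 'v) \<Rightarrow> ('v \<Rightarrow> 'm) \<Rightarrow>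
   ('k, 'm::ab_group_add) vspace \<Rightarrow> ('m \<Rightarrow> 'm \<Rightarrow> 'm) \<Rightarrow> ('m \<Rightarrow> 'm) \<Rightarrow> bool" where
  "diff_lie_subalgebra lam A brA dA \<iota> M brM dM \<longleftrightarrow>
     diff_lie_algebra lam A brA dA \<and> diff_lie_algebra lam M brM dM
     \<and> lin A M \<iota> \<and> inj_on \<iota> (carr A)
     \<and> (\<forall>x\<in>carr A. \<forall>y\<in>carr A. brM (\<iota> x) (\<iota> y) = \<iota> (brA x y))
     \<and> (\<forall>x\<in>carr A. dM (\<iota> x) = \<iota> (dA x))"

definition manin_triple ::
  "'k::field \<Rightarrow> ('k, 'v::ab_group_add) vspace \<Rightarrow> ('v \<Rightarrow> 'v \<Rightarrow> 'v) \<Rightarrow> ('v \<Rightarrow> 'v) \<Rightarrow>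
   (('v \<Rightarrow> 'k) \<Rightarrow> ('v \<Rightarrow> 'k) \<Rightarrow> ('v \<Rightarrow> 'k)) \<Rightarrow> (('v \<Rightarrow> 'k) \<Rightarrow> ('v \<Rightarrow> 'k)) \<Rightarrow> bool" where
  "manin_triple lam L br d brs ds \<longleftrightarrow>
     (let M = dsum L (dual L); brM = double_bracket L br brs; dM = map_prod d ds in
       diff_lie_algebra lam M brM dM
       \<and> diff_lie_subalgebra lam L br d (\<lambda>x. (x, 0)) M brM dM
       \<and> diff_lie_subalgebra lam (dual L) brs ds (\<lambda>a. (0, a)) M brM dM
       \<and> nondegenerate_symmetric M double_form
       \<and> (\<forall>u\<in>carr M. \<forall>v\<in>carr M. \<forall>w\<in>carr M.
            double_form (brM u v) w = double_form u (brM v w)))"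

definition matched_pair_lie ::
  "('k::field, 'v::ab_group_add) vspace \<Rightarrow> ('v \<Rightarrow> 'v \<Rightarrow> 'v) \<Rightarrow>
   ('k, 'w::ab_group_add) vspace \<Rightarrow> ('w \<Rightarrow> 'w \<Rightarrow> 'w) \<Rightarrow>
   ('w \<Rightarrow> 'v \<Rightarrow> 'v) \<Rightarrow> ('v \<Rightarrow> 'w \<Rightarrow> 'w) \<Rightarrow> bool" where
  "matched_pair_lie L br V brV h \<rho> \<longleftrightarrow> lie_algebra L br \<and> lie_algebra V brV
     \<and> lie_rep L br V \<rho> \<and> lie_rep V brV L h
     \<and> (\<forall>x\<in>carr L. \<forall>y\<in>carr L. \<forall>c\<in>carr V.
          br y (h c x) - br x (h c y) - h (\<rho> y c) x + h (\<rho> x c) y + h c (br x y) = 0)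
     \<and> (\<forall>z\<in>carr L. \<forall>a\<in>carr V. \<forall>b\<in>carr V.
          brV b (\<rho> z a) - brV a (\<rho> z b) - \<rho> (h b z) a + \<rho> (h a z) b + \<rho> z (brV a b) = 0)"

definition matched_pair_diff_lie ::
  "'k::field \<Rightarrow> ('k, 'v::ab_group_add) vspace \<Rightarrow> ('v \<Rightarrow> 'v \<Rightarrow> 'v) \<Rightarrow> ('v \<Rightarrow> 'v) \<Rightarrow>
   ('k, 'w::ab_group_add) vspace \<Rightarrow> ('w \<Rightarrow> 'w \<Rightarrow> 'w) \<Rightarrow> ('w \<Rightarrow> 'w) \<Rightarrow>
   ('w \<Rightarrow> 'v \<Rightarrow> 'v) \<Rightarrow> ('v \<Rightarrow> 'w \<Rightarrow> 'w) \<Rightarrow> bool" where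
  "matched_pair_diff_lie lam L br d V brV \<xi> h \<rho> \<longleftrightarrow>
     diff_lie_algebra lam L br d \<and> diff_lie_algebra lam V brV \<xi>
     \<and> matched_pair_lie L br V brV h \<rho>
     \<and> diff_lie_rep lam L br d V \<rho> \<xi>
     \<and> diff_lie_rep lam V brV \<xi> L h d"

end

theory Submission
  imports Defs
begin

text \<open>
  All three conditions say the same about the pair of brackets on \<open>L\<close> and \<open>L\<^sup>*\<close>, and the notion that
  joins them is the matched pair.

  A Manin triple and a matched pair are compared by means of the bicrossed product.  For two Lie
  algebras \<open>L\<close> and \<open>V\<close> acting on each other, the Jacobiator of \<open>L \<oplus> V\<close> is a sum of instances of the two
  compatibility expressions of a matched pair, and each of these is itself a value of the
  Jacobiator (\<open>lie_algebra_bicrossed_iff\<close>).  In the same way the Leibniz rule for the sum of the two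
  differentials reduces to the conditions that the actions respect the differentials
  (\<open>diff_lie_algebra_bicrossed_iff\<close>).  For \<open>V = L\<^sup>*\<close> with the coadjoint actions, the remaining parts of a
  Manin triple hold automatically (\<open>manin_triple_iff_matched_pair\<close>).

  A bialgebra and a matched pair are compared by pairing all identities with functionals.  A tensor in
  \<open>L \<otimes> L\<close> is a bilinear form on \<open>L\<^sup>*\<close>, and \<open>\<delta> x\<close> is the form \<open>(a, b) \<mapsto> \<langle>[a, b], x\<rangle>\<close>; hence the axioms of
  a differential Lie coalgebra are the transposed axioms of the differential Lie algebra \<open>L\<^sup>*\<close>.  The
  cocycle condition for \<open>\<delta>\<close> becomes a scalar identity in \<open>x\<close>, \<open>y\<close>, \<open>a\<close>, \<open>b\<close>.  Each compatibility condition
  of the matched pair is the same identity with one of the four arguments removed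
  (\<open>defect_pairing\<close>).  Finally, the two actions respect the differentials exactly if \<open>D\<close> and \<open>d\<^sup>*\<close> are
  admissible: for \<open>D\<close> by definition, for \<open>d\<^sup>*\<close> after pairing
  (\<open>diff_lie_rep_coad_dual_iff\<close>).
\<close>


section \<open>Linear and bilinear maps on carriers\<close>

lemma vspace_closed:
  assumes "is_vspace V"
  shows "0 \<in> carr V"
    and "\<lbrakk>x \<in> carr V; y \<in> carr V\<rbrakk> \<Longrightarrow> x + y \<in> carr V"
    and "\<lbrakk>x \<in> carr V; y \<in> carr V\<rbrakk> \<Longrightarrow> x - y \<in> carr V"
    and "x \<in> carr V \<Longrightarrow> - x \<in> carr V"
    and "x \<in> carr V \<Longrightarrow> smul V c x \<in> carr V"
    and "(\<And>i. i \<in> I \<Longrightarrow> g i \<in> carr V) \<Longrightarrow> sum g I \<in> carr V"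
proof -
  interpret vector_space "smul V" using assms by (simp add: is_vspace_def)
  have sub: "subspace (carr V)" using assms by (simp add: is_vspace_def)
  show "0 \<in> carr V"
    and "\<lbrakk>x \<in> carr V; y \<in> carr V\<rbrakk> \<Longrightarrow> x + y \<in> carr V"
    and "\<lbrakk>x \<in> carr V; y \<in> carr V\<rbrakk> \<Longrightarrow> x - y \<in> carr V"
    and "x \<in> carr V \<Longrightarrow> - x \<in> carr V"
    and "x \<in> carr V \<Longrightarrow> smul V c x \<in> carr V"
    and "(\<And>i. i \<in> I \<Longrightarrow> g i \<in> carr V) \<Longrightarrow> sum g I \<in> carr V"
    by (simp_all add: subspace_0[OF sub] subspace_add[OF sub] subspace_diff[OF sub]
        subspace_neg[OF sub] subspace_scale[OF sub] subspace_sum[OF sub])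
qed

lemma vspace_scale:
  assumes "is_vspace V"
  shows "smul V c 0 = 0" "smul V c (x + y) = smul V c x + smul V c y"
    and "smul V c (x - y) = smul V c x - smul V c y" "smul V c (- x) = - smul V c x"
    and "smul V c (smul V c' x) = smul V (c * c') x"
proof -
  interpret vector_space "smul V" using assms by (simp add: is_vspace_def)
  show "smul V c 0 = 0" "smul V c (x + y) = smul V c x + smul V c y"
    and "smul V c (x - y) = smul V c x - smul V c y" "smul V c (- x) = - smul V c x"
    and "smul V c (smul V c' x) = smul V (c * c') x"
    by (simp_all add: scale_right_distrib scale_right_diff_distrib)
qed

lemma lin_rules:
  assumes V: "is_vspace V" and W: "is_vspace W" and f: "lin V W f"
  shows "x \<in> carr V \<Longrightarrow> f x \<in> carr W"
    and "f 0 = 0"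
    and "\<lbrakk>x \<in> carr V; y \<in> carr V\<rbrakk> \<Longrightarrow> f (x + y) = f x + f y"
    and "\<lbrakk>x \<in> carr V; y \<in> carr V\<rbrakk> \<Longrightarrow> f (x - y) = f x - f y"
    and "x \<in> carr V \<Longrightarrow> f (- x) = - f x"
    and "x \<in> carr V \<Longrightarrow> f (smul V c x) = smul W c (f x)"
proof -
  interpret V: vector_space "smul V" using V by (simp add: is_vspace_def)
  interpret W: vector_space "smul W" using W by (simp add: is_vspace_def)
  note V_closed = vspace_closed[OF V]
  have add: "f (x + y) = f x + f y" if "x \<in> carr V" "y \<in> carr V" for x y
    using f that by (simp add: lin_def)
  have scale: "f (smul V c x) = smul W c (f x)" if "x \<in> carr V" for c x
    using f that by (simp add: lin_def)
  have neg: "f (- x) = - f x" if "x \<in> carr V" for x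
    using scale[OF that, of "-1"] by simp
  show "x \<in> carr V \<Longrightarrow> f x \<in> carr W" using f by (simp add: lin_def)
  show "f 0 = 0" using scale[OF V_closed(1), of 0] by simp
  show "\<lbrakk>x \<in> carr V; y \<in> carr V\<rbrakk> \<Longrightarrow> f (x - y) = f x - f y"
    using add[of x "- y"] neg[of y] V_closed(4) by simp
  show "\<lbrakk>x \<in> carr V; y \<in> carr V\<rbrakk> \<Longrightarrow> f (x + y) = f x + f y"
    and "x \<in> carr V \<Longrightarrow> f (- x) = - f x"
    and "x \<in> carr V \<Longrightarrow> f (smul V c x) = smul W c (f x)"
    by (simp_all add: add neg scale)
qed

lemma lin_sum:
  assumes V: "is_vspace V" and W: "is_vspace W" and f: "lin V W f"
    and g: "\<And>i. i \<in> I \<Longrightarrow> g i \<in> carr V"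
  shows "f (\<Sum>i\<in>I. g i) = (\<Sum>i\<in>I. f (g i))"
  using g
proof (induction I rule: infinite_finite_induct)
  case (insert i I)
  then have "sum g I \<in> carr V" by (intro vspace_closed(6)[OF V]) auto
  with insert show ?case by (simp add: lin_rules(3)[OF V W f])
qed (simp_all add: lin_rules(2)[OF V W f])

lemma bilin_rules:
  assumes V: "is_vspace V" and W: "is_vspace W" and U: "is_vspace U" and f: "bilin V W U f"
  shows "\<lbrakk>x \<in> carr V; y \<in> carr W\<rbrakk> \<Longrightarrow> f x y \<in> carr U"
    and "x \<in> carr V \<Longrightarrow> f x 0 = 0"
    and "y \<in> carr W \<Longrightarrow> f 0 y = 0"
    and "\<lbrakk>x \<in> carr V; x' \<in> carr V; y \<in> carr W\<rbrakk> \<Longrightarrow> f (x + x') y = f x y + f x' y"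
    and "\<lbrakk>x \<in> carr V; x' \<in> carr V; y \<in> carr W\<rbrakk> \<Longrightarrow> f (x - x') y = f x y - f x' y"
    and "\<lbrakk>x \<in> carr V; y \<in> carr W\<rbrakk> \<Longrightarrow> f (- x) y = - f x y"
    and "\<lbrakk>x \<in> carr V; y \<in> carr W\<rbrakk> \<Longrightarrow> f (smul V c x) y = smul U c (f x y)"
    and "\<lbrakk>x \<in> carr V; y \<in> carr W; y' \<in> carr W\<rbrakk> \<Longrightarrow> f x (y + y') = f x y + f x y'"
    and "\<lbrakk>x \<in> carr V; y \<in> carr W; y' \<in> carr W\<rbrakk> \<Longrightarrow> f x (y - y') = f x y - f x y'"
    and "\<lbrakk>x \<in> carr V; y \<in> carr W\<rbrakk> \<Longrightarrow> f x (- y) = - f x y"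
    and "\<lbrakk>x \<in> carr V; y \<in> carr W\<rbrakk> \<Longrightarrow> f x (smul W c y) = smul U c (f x y)"
proof -
  have l: "lin W U (f x)" if "x \<in> carr V" for x using f that by (simp add: bilin_def)
  have r: "lin V U (\<lambda>x. f x y)" if "y \<in> carr W" for y using f that by (simp add: bilin_def)
  note L = lin_rules[OF W U l] and R = lin_rules[OF V U r]
  show "\<lbrakk>x \<in> carr V; y \<in> carr W\<rbrakk> \<Longrightarrow> f x y \<in> carr U"
    and "x \<in> carr V \<Longrightarrow> f x 0 = 0"
    and "y \<in> carr W \<Longrightarrow> f 0 y = 0"
    and "\<lbrakk>x \<in> carr V; x' \<in> carr V; y \<in> carr W\<rbrakk> \<Longrightarrow> f (x + x') y = f x y + f x' y"
    and "\<lbrakk>x \<in> carr V; x' \<in> carr V; y \<in> carr W\<rbrakk> \<Longrightarrow> f (x - x') y = f x y - f x' y"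
    and "\<lbrakk>x \<in> carr V; y \<in> carr W\<rbrakk> \<Longrightarrow> f (- x) y = - f x y"
    and "\<lbrakk>x \<in> carr V; y \<in> carr W\<rbrakk> \<Longrightarrow> f (smul V c x) y = smul U c (f x y)"
    and "\<lbrakk>x \<in> carr V; y \<in> carr W; y' \<in> carr W\<rbrakk> \<Longrightarrow> f x (y + y') = f x y + f x y'"
    and "\<lbrakk>x \<in> carr V; y \<in> carr W; y' \<in> carr W\<rbrakk> \<Longrightarrow> f x (y - y') = f x y - f x y'"
    and "\<lbrakk>x \<in> carr V; y \<in> carr W\<rbrakk> \<Longrightarrow> f x (- y) = - f x y"
    and "\<lbrakk>x \<in> carr V; y \<in> carr W\<rbrakk> \<Longrightarrow> f x (smul W c y) = smul U c (f x y)"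
    by (simp_all add: L R)
qed

lemma lin_compose:
  assumes "lin V W f" "lin W U g"
  shows "lin V U (\<lambda>x. g (f x))"
  using assms by (simp add: lin_def)

lemma lin_id: "lin V V id"
  by (simp add: lin_def)


section \<open>Dual spaces and dual bases\<close>

lemma scalars_simps [simp]: "carr scalars = UNIV" "smul scalars = (*)"
  by (simp_all add: scalars_def)

lemma smul_dual [simp]: "smul (dual V) = fsmul"
  by (simp add: dual_def)

lemma dual_lin: "a \<in> carr (dual V) \<Longrightarrow> lin V scalars a"
  and dual_outside: "a \<in> carr (dual V) \<Longrightarrow> x \<notin> carr V \<Longrightarrow> a x = 0"
  by (simp_all add: dual_def)

lemma dual_rules:
  assumes "is_vspace V" and "a \<in> carr (dual V)"
  shows "a 0 = 0"
    and "\<lbrakk>x \<in> carr V; y \<in> carr V\<rbrakk> \<Longrightarrow> a (x + y) = a x + a y"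
    and "\<lbrakk>x \<in> carr V; y \<in> carr V\<rbrakk> \<Longrightarrow> a (x - y) = a x - a y"
    and "x \<in> carr V \<Longrightarrow> a (- x) = - a x"
    and "x \<in> carr V \<Longrightarrow> a (smul V c x) = c * a x"
  using lin_rules[OF assms(1) is_vspace_scalars dual_lin[OF assms(2)]] by simp_all

lemma dual_eqI:
  assumes "a \<in> carr (dual V)" "b \<in> carr (dual V)" "\<And>x. x \<in> carr V \<Longrightarrow> a x = b x"
  shows "a = b"
proof
  fix x show "a x = b x"
    using assms dual_outside[of a V x] dual_outside[of b V x] by (cases "x \<in> carr V") auto
qed

lemma eq_if_dual_eq:
  assumes V: "is_vspace V" and x: "x \<in> carr V" "y \<in> carr V"
    and eq: "\<And>b. b \<in> carr (dual V) \<Longrightarrow> b x = b y"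
  shows "x = y"
proof -
  have "\<forall>b\<in>carr (dual V). b (x - y) = 0"
  proof
    fix b assume "b \<in> carr (dual V)"
    then show "b (x - y) = 0" using dual_rules(3)[OF V _ x, of b] eq[of b] by simp
  qed
  then have "x - y = 0"
    using dual_separates[OF V] vspace_closed(3)[OF V x] by blast
  then show ?thesis by simp
qed

lemma dual_map_in:
  assumes "lin V W f" "a \<in> carr (dual W)" "is_vspace V"
  shows "dual_map V f a \<in> carr (dual V)"
  using assms vspace_closed[OF assms(3)] by (simp add: dual_map_def dual_def lin_def)

lemma lin_dual_map:
  assumes "lin V W f" "is_vspace V"
  shows "lin (dual W) (dual V) (dual_map V f)"
  using dual_map_in[OF assms(1) _ assms(2)]
  by (auto simp: lin_def dual_map_def fun_eq_iff fsmul_def)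

lemma sum_fun_apply: "(\<Sum>i\<in>I. g i) x = (\<Sum>i\<in>I. g i x)"
  for g :: "'i \<Rightarrow> 'a \<Rightarrow> 'b::comm_monoid_add"
  by (induction I rule: infinite_finite_induct) simp_all

text \<open>
  Finite dimension enters the proof through this lemma only: tensors get coordinates, and every
  functional on the dual space comes from a vector.  The functionals \<open>e b\<close> are the coordinates of a
  basis, and the last conclusion is the expansion of a functional in the dual basis.
\<close>

lemma finite_dual_basis:
  fixes V :: "('k::field, 'v::ab_group_add) vspace"
  assumes V: "is_vspace V" and fin: "fin_dim V"
  obtains B e where "finite B" "B \<subseteq> carr V" "\<And>b. b \<in> B \<Longrightarrow> e b \<in> carr (dual V)"
    and "\<And>b b'. b \<in> B \<Longrightarrow> b' \<in> B \<Longrightarrow> e b b' = (if b' = b then 1 else 0)"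
    and "\<And>a x. a \<in> carr (dual V) \<Longrightarrow> x \<in> carr V \<Longrightarrow> a x = (\<Sum>b\<in>B. e b x * a b)"
proof -
  interpret vector_space "smul V" using V by (simp add: is_vspace_def)
  obtain B0 where B0: "finite B0" "carr V = span B0" using fin by (auto simp: fin_dim_def)
  obtain B where B: "B \<subseteq> carr V" "independent B" "carr V \<subseteq> span B"
    using maximal_independent_subset by blast
  have finB: "finite B" using independent_span_bound[OF B0(1) B(2)] B(1) B0(2) by blast
  have "\<forall>b\<in>B. \<exists>f. f \<in> carr (dual V) \<and> (\<forall>b'\<in>B. f b' = (if b' = b then 1 else 0))"
    using coordinate_functional[OF V B(1,2)] by blast
  then obtain e where e: "\<forall>b\<in>B. e b \<in> carr (dual V) \<and> (\<forall>b'\<in>B. e b b' = (if b' = b then 1 else 0))"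
    by (rule bchoice[THEN exE])
  have lin: "lin V V (\<lambda>x. \<Sum>b\<in>B. smul V (e b x) b)"
    unfolding lin_def
  proof (intro conjI ballI allI)
    fix x assume x: "x \<in> carr V"
    show "(\<Sum>b\<in>B. smul V (e b x) b) \<in> carr V"
      using B(1) by (intro vspace_closed(5,6)[OF V]) auto
    show "(\<Sum>b\<in>B. smul V (e b (smul V c x)) b) = smul V c (\<Sum>b\<in>B. smul V (e b x) b)" for c
      using e x by (auto simp: dual_rules[OF V] scale_sum_right intro!: sum.cong)
    fix y assume y: "y \<in> carr V"
    show "(\<Sum>b\<in>B. smul V (e b (x + y)) b) = (\<Sum>b\<in>B. smul V (e b x) b) + (\<Sum>b\<in>B. smul V (e b y) b)"
      using e x y
      by (auto simp: dual_rules[OF V] scale_left_distrib sum.distrib[symmetric] intro!: sum.cong)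
  qed
  have expand: "(\<Sum>b\<in>B. smul V (e b x) b) = x" if x: "x \<in> carr V" for x
  proof -
    have "(\<Sum>b\<in>B. smul V (e b x) b) = id x"
    proof (rule lin_eq_on_span[OF V V lin lin_id B(1)])
      show "x \<in> span B" using x B(3) by blast
      fix b assume b: "b \<in> B"
      have "(\<Sum>b'\<in>B. smul V (e b' b) b') = (\<Sum>b'\<in>B. if b' = b then b' else 0)"
        using e b by (intro sum.cong) auto
      then show "(\<Sum>b'\<in>B. smul V (e b' b) b') = id b" using b finB by simp
    qed
    then show ?thesis by simp
  qed
  have dual_expand: "a x = (\<Sum>b\<in>B. e b x * a b)" if a: "a \<in> carr (dual V)" and x: "x \<in> carr V" for a x
  proof -
    have "a x = a (\<Sum>b\<in>B. smul V (e b x) b)" by (simp add: expand[OF x])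
    also have "\<dots> = (\<Sum>b\<in>B. a (smul V (e b x) b))"
      using B(1) by (intro lin_sum[OF V is_vspace_scalars dual_lin[OF a]] vspace_closed(5)[OF V]) auto
    also have "\<dots> = (\<Sum>b\<in>B. e b x * a b)"
      using B(1) by (intro sum.cong) (auto simp: dual_rules[OF V a])
    finally show ?thesis .
  qed
  show thesis
  proof (rule that[of B e])
    show "finite B" "B \<subseteq> carr V" by (fact finB, fact B(1))
    show "e b \<in> carr (dual V)" if "b \<in> B" for b using e that by blast
    show "e b b' = (if b' = b then 1 else 0)" if "b \<in> B" "b' \<in> B" for b b' using e that by blast
  qed (fact dual_expand)
qed

text \<open>
  The bijection between \<open>V\<close> and its bidual.  The unique \<open>z\<close> has the coordinates \<open>\<phi> (e b)\<close>; this is the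
  form in which the coadjoint action of the dual Lie algebra is specified.
\<close>

lemma dual_reflexive:
  fixes V :: "('k::field, 'v::ab_group_add) vspace"
  assumes V: "is_vspace V" and fin: "fin_dim V" and \<phi>: "lin (dual V) scalars \<phi>"
  shows "\<exists>!z. z \<in> carr V \<and> (\<forall>b\<in>carr (dual V). b z = \<phi> b)"
proof (rule ex_ex1I)
  obtain B e where B: "finite B" "B \<subseteq> carr V" "\<And>b. b \<in> B \<Longrightarrow> e b \<in> carr (dual V)"
    and "\<And>b b'. b \<in> B \<Longrightarrow> b' \<in> B \<Longrightarrow> e b b' = (if b' = b then 1 else 0)"
    and exp: "\<And>a x. a \<in> carr (dual V) \<Longrightarrow> x \<in> carr V \<Longrightarrow> a x = (\<Sum>b\<in>B. e b x * a b)"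
    by (rule finite_dual_basis[OF V fin]) blast
  note V' = is_vspace_dual[OF V]
  define z where "z = (\<Sum>b\<in>B. smul V (\<phi> (e b)) b)"
  have z: "z \<in> carr V" unfolding z_def using B(2) by (intro vspace_closed(5,6)[OF V]) auto
  have "a z = \<phi> a" if a: "a \<in> carr (dual V)" for a
  proof -
    have "a z = (\<Sum>b\<in>B. a (smul V (\<phi> (e b)) b))" unfolding z_def
      using B(2) by (intro lin_sum[OF V is_vspace_scalars dual_lin[OF a]] vspace_closed(5)[OF V]) auto
    also have "\<dots> = (\<Sum>b\<in>B. \<phi> (fsmul (a b) (e b)))"
    proof (rule sum.cong)
      fix b assume "b \<in> B"
      then show "a (smul V (\<phi> (e b)) b) = \<phi> (fsmul (a b) (e b))"
        using B(2,3) lin_rules(6)[OF V' is_vspace_scalars \<phi>, of "e b" "a b"] dual_rules(5)[OF V a, of b]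
        by auto
    qed simp
    also have "\<dots> = \<phi> (\<Sum>b\<in>B. fsmul (a b) (e b))"
      using B(3) vspace_closed(5)[OF V', of "e _"]
      by (intro lin_sum[OF V' is_vspace_scalars \<phi>, symmetric]) auto
    also have "(\<Sum>b\<in>B. fsmul (a b) (e b)) = a"
    proof (rule dual_eqI[of _ V])
      show "(\<Sum>b\<in>B. fsmul (a b) (e b)) \<in> carr (dual V)"
        using B(3) vspace_closed(5)[OF V', of "e _"] by (intro vspace_closed(6)[OF V']) auto
      show "(\<Sum>b\<in>B. fsmul (a b) (e b)) x = a x" if "x \<in> carr V" for x
        using exp[OF a that] by (simp add: sum_fun_apply fsmul_def mult.commute)
    qed (rule a)
    finally show ?thesis .
  qed
  with z show "\<exists>z. z \<in> carr V \<and> (\<forall>b\<in>carr (dual V). b z = \<phi> b)" by blast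
next
  fix z z'
  assume "z \<in> carr V \<and> (\<forall>b\<in>carr (dual V). b z = \<phi> b)"
    and "z' \<in> carr V \<and> (\<forall>b\<in>carr (dual V). b z' = \<phi> b)"
  then show "z = z'" by (intro eq_if_dual_eq[OF V]) simp_all
qed


section \<open>Tensors as bilinear forms on the duals\<close>

lemma smul_tensor [simp]: "smul (tensor V W) = fsmul"
  by (simp add: tensor_def)

lemma scaled_pure_in_tensor:
  "x \<in> carr V \<Longrightarrow> y \<in> carr W \<Longrightarrow> fsmul c (pure V W x y) \<in> carr (tensor V W)"
  using vspace_closed(5)[OF is_vspace_tensor, of "pure V W x y" V W c] pure_in_tensor[of x V y W]
  by simp

text \<open>
  All values of maps on tensors below are computed with this lemma: both sides are linear in the
  tensor, so it is enough to compare them on pure tensors.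
\<close>

lemma lin_eq_on_tensor:
  assumes U: "is_vspace U" and F: "lin (tensor V W) U F" and G: "lin (tensor V W) U G"
    and eq: "\<And>x y. x \<in> carr V \<Longrightarrow> y \<in> carr W \<Longrightarrow> F (pure V W x y) = G (pure V W x y)"
    and t: "t \<in> carr (tensor V W)"
  shows "F t = G t"
proof (rule lin_eq_on_span[OF is_vspace_tensor U F G])
  show "t \<in> module.span (smul (tensor V W)) {pure V W x y | x y. x \<in> carr V \<and> y \<in> carr W}"
    using t by (simp add: tensor_def)
  show "{pure V W x y | x y. x \<in> carr V \<and> y \<in> carr W} \<subseteq> carr (tensor V W)"
    using pure_in_tensor[of _ V _ W] by blast
  show "F p = G p" if "p \<in> {pure V W x y | x y. x \<in> carr V \<and> y \<in> carr W}" for p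
    using that eq by blast
qed

lemma pure_eval:
  assumes "a \<in> carr (dual V)" "b \<in> carr (dual W)"
  shows "pure V W x y (a, b) = a x * b y"
  using assms by (simp add: pure_def)

lemma lin_eval: "lin (tensor V W) scalars (\<lambda>t. t p)"
  by (simp add: lin_def fsmul_def)

text \<open>
  Tensors vanish off the pairs of functionals, because pure tensors do; hence a tensor is known from
  its values as a bilinear form, and an identity between tensors is a family of scalar identities.
\<close>

lemma tensor_eval_outside:
  assumes "t \<in> carr (tensor V W)" "a \<notin> carr (dual V) \<or> b \<notin> carr (dual W)"
  shows "t (a, b) = 0"
proof -
  have "lin (tensor V W) scalars (\<lambda>t. 0)" by (simp add: lin_def)
  from lin_eq_on_tensor[OF is_vspace_scalars lin_eval this _ assms(1)] show ?thesis
    using assms(2) by (auto simp: pure_def)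
qed

lemma tensor_eqI:
  assumes "s \<in> carr (tensor V W)" "t \<in> carr (tensor V W)"
    and "\<And>a b. a \<in> carr (dual V) \<Longrightarrow> b \<in> carr (dual W) \<Longrightarrow> s (a, b) = t (a, b)"
  shows "s = t"
proof
  fix p show "s p = t p"
    using assms(3)[of "fst p" "snd p"] tensor_eval_outside[OF assms(1), of "fst p" "snd p"]
      tensor_eval_outside[OF assms(2), of "fst p" "snd p"]
    by (cases "fst p \<in> carr (dual V) \<and> snd p \<in> carr (dual W)") auto
qed

lemma tensor_lift_outside:
  assumes "is_vspace V" "is_vspace W" "is_vspace U" "bilin V W U \<beta>" "t \<notin> carr (tensor V W)"
  shows "tensor_lift V W U \<beta> t = 0"
  using theI'[OF tensor_universal[OF assms(1-4)]] assms(5) by (simp add: tensor_lift_def)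

lemma tensor_pairing:
  assumes V: "is_vspace V" and a: "a \<in> carr (dual V)" "b \<in> carr (dual V)"
  shows "tensor_pairing V a b \<in> carr (dual (tensor V V))"
    and "t \<in> carr (tensor V V) \<Longrightarrow> tensor_pairing V a b t = t (a, b)"
proof -
  have bil: "bilin V V scalars (\<lambda>x y. a x * b y)"
    using dual_rules[OF V a(1)] dual_rules[OF V a(2)]
    by (auto simp: bilin_def lin_def algebra_simps)
  note lift = tensor_lift[OF V V is_vspace_scalars bil, folded tensor_pairing_def]
  show "tensor_pairing V a b \<in> carr (dual (tensor V V))"
    using lift(1) tensor_lift_outside[OF V V is_vspace_scalars bil, folded tensor_pairing_def]
    by (simp add: dual_def)
  show "tensor_pairing V a b t = t (a, b)" if t: "t \<in> carr (tensor V V)"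
    by (rule lin_eq_on_tensor[OF is_vspace_scalars lift(1) lin_eval _ t])
      (simp add: lift(2) pure_eval a)
qed

text \<open>
  On bilinear forms, \<open>f \<otimes> g\<close> is the substitution of the dual maps.  This turns the coalgebra
  identities, which apply maps to a cobracket, into identities for the dual bracket.
\<close>

lemma tensor_map:
  assumes V: "is_vspace V" and W: "is_vspace W" and V': "is_vspace V'" and W': "is_vspace W'"
    and f: "lin V V' f" and g: "lin W W' g"
  shows "lin (tensor V W) (tensor V' W') (tensor_map V W V' W' f g)"
    and "\<lbrakk>a \<in> carr (dual V'); b \<in> carr (dual W'); t \<in> carr (tensor V W)\<rbrakk>
           \<Longrightarrow> tensor_map V W V' W' f g t (a, b) = t (dual_map V f a, dual_map W g b)"
proof -
  have f_in: "f x \<in> carr V'" if "x \<in> carr V" for x using f that by (simp add: lin_def)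
  have g_in: "g y \<in> carr W'" if "y \<in> carr W" for y using g that by (simp add: lin_def)
  have pure_l: "lin V (tensor V' W') (\<lambda>x. pure V' W' (f x) y)" if "y \<in> carr W'" for y
    by (rule lin_compose[OF f]) (use bilin_pure[OF V' W'] that in \<open>simp add: bilin_def\<close>)
  have pure_r: "lin W (tensor V' W') (\<lambda>y. pure V' W' x (g y))" if "x \<in> carr V'" for x
    by (rule lin_compose[OF g]) (use bilin_pure[OF V' W'] that in \<open>simp add: bilin_def\<close>)
  have bil: "bilin V W (tensor V' W') (\<lambda>x y. pure V' W' (f x) (g y))"
    using pure_l pure_r f_in g_in by (simp add: bilin_def)
  note lift = tensor_lift[OF V W is_vspace_tensor bil, folded tensor_map_def]
  show "lin (tensor V W) (tensor V' W') (tensor_map V W V' W' f g)" by (rule lift(1))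
  assume a: "a \<in> carr (dual V')" and b: "b \<in> carr (dual W')" and t: "t \<in> carr (tensor V W)"
  note in_dual = dual_map_in[OF f a V] dual_map_in[OF g b W]
  show "tensor_map V W V' W' f g t (a, b) = t (dual_map V f a, dual_map W g b)"
    by (rule lin_eq_on_tensor[OF is_vspace_scalars lin_compose[OF lift(1) lin_eval] lin_eval _ t])
      (simp add: lift(2) pure_eval a b in_dual, simp add: dual_map_def)
qed

lemma flip:
  assumes V: "is_vspace V"
  shows "lin (tensor V V) (tensor V V) (flip V)"
    and "\<lbrakk>a \<in> carr (dual V); b \<in> carr (dual V); t \<in> carr (tensor V V)\<rbrakk> \<Longrightarrow> flip V t (a, b) = t (b, a)"
proof -
  have bil: "bilin V V (tensor V V) (\<lambda>x y. pure V V y x)"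
    using bilin_pure[OF V V] by (simp add: bilin_def)
  note lift = tensor_lift[OF V V is_vspace_tensor bil, folded flip_def]
  show "lin (tensor V V) (tensor V V) (flip V)" by (rule lift(1))
  assume ab: "a \<in> carr (dual V)" "b \<in> carr (dual V)" and t: "t \<in> carr (tensor V V)"
  show "flip V t (a, b) = t (b, a)"
    by (rule lin_eq_on_tensor[OF is_vspace_scalars lin_compose[OF lift(1) lin_eval] lin_eval _ t])
      (simp add: lift(2) pure_eval ab)
qed

text \<open>
  A threefold tensor is evaluated at a functional and a functional \<open>b \<otimes> c\<close> on \<open>V \<otimes> V\<close>; the
  permutation \<open>x \<otimes> (y \<otimes> z) \<mapsto> y \<otimes> (z \<otimes> x)\<close> then permutes the three functionals in the opposite direction.
\<close>

lemma cyc: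
  assumes V: "is_vspace V"
  shows "lin (tensor V (tensor V V)) (tensor V (tensor V V)) (cyc V)"
    and "\<lbrakk>a \<in> carr (dual V); b \<in> carr (dual V); c \<in> carr (dual V); T \<in> carr (tensor V (tensor V V))\<rbrakk>
      \<Longrightarrow> cyc V T (a, tensor_pairing V b c) = T (c, tensor_pairing V a b)"
proof -
  let ?VV = "tensor V V" and ?VVV = "tensor V (tensor V V)"
  note vVV = is_vspace_tensor[of V V] and vVVV = is_vspace_tensor[of V ?VV]
  let ?\<beta> = "\<lambda>x y z. pure V ?VV y (pure V V z x)"
  let ?F = "\<lambda>x. tensor_lift V V ?VVV (?\<beta> x)"
  note pure_rules = bilin_rules[OF V V vVV bilin_pure[OF V V]]
  note pure_rules' = bilin_rules[OF V vVV vVVV bilin_pure[OF V vVV]]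
  have bil: "bilin V V ?VVV (?\<beta> x)" if "x \<in> carr V" for x
    unfolding bilin_def lin_def
    using that pure_rules pure_rules' by simp
  note F = tensor_lift[OF V V vVVV bil]
  \<comment> \<open>The inner lift is linear in its parameter \<open>x\<close> because a lift is determined by its values on pure
    tensors, and these are linear in \<open>x\<close>.\<close>
  have F_lin: "lin V ?VVV (\<lambda>x. ?F x t)" if t: "t \<in> carr ?VV" for t
    unfolding lin_def
  proof (intro conjI ballI allI)
    fix x c assume x: "x \<in> carr V"
    show "?F x t \<in> carr ?VVV" using F(1)[OF x] t by (simp add: lin_def)
    have cx: "smul V c x \<in> carr V" using x by (rule vspace_closed(5)[OF V])
    have "lin ?VV ?VVV (\<lambda>t. smul ?VVV c (?F x t))"
      using F(1)[OF x] vspace_closed(5)[OF vVVV] vspace_scale[OF vVVV]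
      by (simp add: lin_def mult.commute)
    from lin_eq_on_tensor[OF vVVV F(1)[OF cx] this _ t]
    show "?F (smul V c x) t = smul ?VVV c (?F x t)"
      using x cx pure_rules pure_rules' by (simp add: F(2))
    fix x' assume x': "x' \<in> carr V"
    have xx': "x + x' \<in> carr V" using x x' by (rule vspace_closed(2)[OF V])
    have "lin ?VV ?VVV (\<lambda>t. ?F x t + ?F x' t)"
      using F(1)[OF x] F(1)[OF x'] vspace_closed(2)[OF vVVV] vspace_scale[OF vVVV]
      by (simp add: lin_def algebra_simps)
    from lin_eq_on_tensor[OF vVVV F(1)[OF xx'] this _ t]
    show "?F (x + x') t = ?F x t + ?F x' t"
      using x x' xx' pure_rules pure_rules' by (simp add: F(2))
  qed
  have bil_F: "bilin V ?VV ?VVV ?F"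
    using F(1) F_lin by (simp add: bilin_def)
  note lift = tensor_lift[OF V vVV vVVV bil_F, folded cyc_def]
  show "lin ?VVV ?VVV (cyc V)" by (rule lift(1))
  assume a: "a \<in> carr (dual V)" and b: "b \<in> carr (dual V)" and c: "c \<in> carr (dual V)"
    and T: "T \<in> carr ?VVV"
  note pab = tensor_pairing[OF V a b] and pbc = tensor_pairing[OF V b c]
  show "cyc V T (a, tensor_pairing V b c) = T (c, tensor_pairing V a b)"
  proof (rule lin_eq_on_tensor[OF is_vspace_scalars lin_compose[OF lift(1) lin_eval] lin_eval _ T])
    fix x s assume x: "x \<in> carr V" and s: "s \<in> carr ?VV"
    have "lin ?VV scalars (\<lambda>s. c x * s (a, b))"
      by (simp add: lin_def fsmul_def algebra_simps)
    from lin_eq_on_tensor[OF is_vspace_scalars lin_compose[OF F(1)[OF x] lin_eval] this _ s]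
    have "?F x s (a, tensor_pairing V b c) = c x * s (a, b)"
      using x by (simp add: F(2) pure_eval pbc a b c pure_in_tensor)
    then show "cyc V (pure V ?VV x s) (a, tensor_pairing V b c)
        = pure V ?VV x s (c, tensor_pairing V a b)"
      using x s by (simp add: lift(2) pure_eval pab c)
  qed
qed


section \<open>Coordinates of tensors\<close>

lemma tensor_coordinates:
  fixes V :: "('k::field, 'v::ab_group_add) vspace"
  assumes V: "is_vspace V" and "B \<subseteq> carr V" and e: "\<And>b. b \<in> B \<Longrightarrow> e b \<in> carr (dual V)"
    and exp: "\<And>a x. a \<in> carr (dual V) \<Longrightarrow> x \<in> carr V \<Longrightarrow> a x = (\<Sum>b\<in>B. e b x * a b)"
    and t: "t \<in> carr (tensor V V)"
  shows "t = (\<Sum>p\<in>B \<times> B. fsmul (t (e (fst p), e (snd p))) (pure V V (fst p) (snd p)))"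
proof (rule tensor_eqI[of _ V V])
  show "(\<Sum>p\<in>B \<times> B. fsmul (t (e (fst p), e (snd p))) (pure V V (fst p) (snd p))) \<in> carr (tensor V V)"
    using assms(2) by (intro vspace_closed(6)[OF is_vspace_tensor] scaled_pure_in_tensor) auto
  fix a c assume a: "a \<in> carr (dual V)" and c: "c \<in> carr (dual V)"
  have lin: "lin (tensor V V) scalars (\<lambda>t. \<Sum>p\<in>B \<times> B. t (e (fst p), e (snd p)) * (a (fst p) * c (snd p)))"
    by (simp add: lin_def fsmul_def algebra_simps sum.distrib sum_distrib_left)
  have "t (a, c) = (\<Sum>p\<in>B \<times> B. t (e (fst p), e (snd p)) * (a (fst p) * c (snd p)))"
  proof (rule lin_eq_on_tensor[OF is_vspace_scalars lin_eval lin _ t])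
    fix x y assume x: "x \<in> carr V" and y: "y \<in> carr V"
    have "pure V V x y (a, c) = (\<Sum>b\<in>B. e b x * a b) * (\<Sum>b\<in>B. e b y * c b)"
      using exp[OF a x] exp[OF c y] by (simp add: pure_eval a c)
    also have "\<dots> = (\<Sum>p\<in>B \<times> B. e (fst p) x * e (snd p) y * (a (fst p) * c (snd p)))"
      by (simp add: sum_product sum.cartesian_product case_prod_unfold mult_ac)
    also have "\<dots> = (\<Sum>p\<in>B \<times> B. pure V V x y (e (fst p), e (snd p)) * (a (fst p) * c (snd p)))"
      by (intro sum.cong) (auto simp: pure_eval e)
    finally show "pure V V x y (a, c)
        = (\<Sum>p\<in>B \<times> B. pure V V x y (e (fst p), e (snd p)) * (a (fst p) * c (snd p)))" .
  qed
  then show "t (a, c) = (\<Sum>p\<in>B \<times> B. fsmul (t (e (fst p), e (snd p))) (pure V V (fst p) (snd p))) (a, c)"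
    by (simp add: sum_fun_apply fsmul_def pure_eval a c)
qed (rule t)

text \<open>
  Over a field of characteristic 2 an antisymmetric tensor need not have the form \<open>t - flip t\<close>; an
  alternating one does.  For \<open>t\<close> one takes the part of the coordinate matrix above the diagonal, with
  respect to some linear order of the basis.
\<close>

lemma alternating_tensor:
  fixes V :: "('k::field, 'v::ab_group_add) vspace"
  assumes V: "is_vspace V" and fin: "fin_dim V" and s: "s \<in> carr (tensor V V)"
    and alt: "\<And>a. a \<in> carr (dual V) \<Longrightarrow> s (a, a) = 0"
    and anti: "\<And>a b. a \<in> carr (dual V) \<Longrightarrow> b \<in> carr (dual V) \<Longrightarrow> s (a, b) = - s (b, a)"
  shows "\<exists>t\<in>carr (tensor V V). s = t - flip V t"
proof -
  obtain B e where B: "finite B" "B \<subseteq> carr V" "\<And>b. b \<in> B \<Longrightarrow> e b \<in> carr (dual V)"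
    and delta: "\<And>b b'. b \<in> B \<Longrightarrow> b' \<in> B \<Longrightarrow> e b b' = (if b' = b then 1 else 0)"
    and exp: "\<And>a x. a \<in> carr (dual V) \<Longrightarrow> x \<in> carr V \<Longrightarrow> a x = (\<Sum>b\<in>B. e b x * a b)"
    by (rule finite_dual_basis[OF V fin]) blast
  note vT = is_vspace_tensor[of V V]
  obtain f :: "'v \<Rightarrow> nat" where f: "inj_on f B"
    using B(1) finite_imp_inj_to_nat_seg by metis
  let ?c = "\<lambda>p. if f (fst p) < f (snd p) then s (e (fst p), e (snd p)) else 0"
  define t where "t = (\<Sum>p\<in>B \<times> B. fsmul (?c p) (pure V V (fst p) (snd p)))"
  have t: "t \<in> carr (tensor V V)"
    unfolding t_def using B(2) by (intro vspace_closed(6)[OF vT] scaled_pure_in_tensor) auto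
  have t_eval: "t (e b, e b') = (if f b < f b' then s (e b, e b') else 0)"
    if b: "b \<in> B" and b': "b' \<in> B" for b b'
  proof -
    have "t (e b, e b') = (\<Sum>p\<in>B \<times> B. ?c p * (e b (fst p) * e b' (snd p)))"
      unfolding t_def by (simp add: sum_fun_apply fsmul_def pure_eval B(3) b b')
    also have "\<dots> = (\<Sum>p\<in>B \<times> B. if p = (b, b') then ?c p else 0)"
      by (rule sum.cong) (auto simp: delta b b' split: if_splits)
    finally show ?thesis using B(1) b b' by simp
  qed
  have ft: "flip V t \<in> carr (tensor V V)" using flip(1)[OF V] t by (simp add: lin_def)
  have d: "t - flip V t \<in> carr (tensor V V)" using t ft by (rule vspace_closed(3)[OF vT])
  have "s (e b, e b') = (t - flip V t) (e b, e b')" if b: "b \<in> B" and b': "b' \<in> B" for b b'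
  proof -
    have "flip V t (e b, e b') = t (e b', e b)" by (rule flip(2)[OF V]) (use B(3) b b' t in auto)
    moreover have "f b = f b' \<Longrightarrow> b = b'" using f b b' by (simp add: inj_onD)
    ultimately show ?thesis
      using t_eval[OF b b'] t_eval[OF b' b] anti[of "e b" "e b'"] alt[of "e b"] B(3) b b'
      by (cases "f b" "f b'" rule: linorder_cases) auto
  qed
  then have "(\<Sum>p\<in>B \<times> B. fsmul (s (e (fst p), e (snd p))) (pure V V (fst p) (snd p)))
      = (\<Sum>p\<in>B \<times> B. fsmul ((t - flip V t) (e (fst p), e (snd p))) (pure V V (fst p) (snd p)))"
    by (intro sum.cong) auto
  then have "s = t - flip V t"
    using tensor_coordinates[OF V B(2,3) exp s] tensor_coordinates[OF V B(2,3) exp d]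
    by (simp only:)
  with t show ?thesis by blast
qed

text \<open>
  The functionals \<open>b \<otimes> c\<close> span the dual of \<open>V \<otimes> V\<close>: if \<open>\<phi>\<close> is any functional, then
  \<open>\<phi> = \<Sum> \<phi> (b \<otimes> b') (e b \<otimes> e b')\<close> over the pairs of basis vectors.  So they suffice to detect
  threefold tensors.
\<close>

lemma tensor3_eq_0:
  fixes V :: "('k::field, 'v::ab_group_add) vspace"
  assumes V: "is_vspace V" and fin: "fin_dim V" and T: "T \<in> carr (tensor V (tensor V V))"
    and 0: "\<And>a b c. \<lbrakk>a \<in> carr (dual V); b \<in> carr (dual V); c \<in> carr (dual V)\<rbrakk>
      \<Longrightarrow> T (a, tensor_pairing V b c) = 0"
  shows "T = 0"
proof -
  obtain B e where B: "finite B" "B \<subseteq> carr V" "\<And>b. b \<in> B \<Longrightarrow> e b \<in> carr (dual V)"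
    and "\<And>b b'. b \<in> B \<Longrightarrow> b' \<in> B \<Longrightarrow> e b b' = (if b' = b then 1 else 0)"
    and exp: "\<And>a x. a \<in> carr (dual V) \<Longrightarrow> x \<in> carr V \<Longrightarrow> a x = (\<Sum>b\<in>B. e b x * a b)"
    by (rule finite_dual_basis[OF V fin]) blast
  let ?VV = "tensor V V"
  note vT = is_vspace_tensor[of V V]
  have "T (a, \<phi>) = 0" if a: "a \<in> carr (dual V)" and \<phi>: "\<phi> \<in> carr (dual ?VV)" for a \<phi>
  proof -
    let ?w = "\<lambda>p. \<phi> (pure V V (fst p) (snd p))"
    let ?q = "\<lambda>p. tensor_pairing V (e (fst p)) (e (snd p))"
    have lin: "lin (tensor V ?VV) scalars (\<lambda>T. \<Sum>p\<in>B \<times> B. ?w p * T (a, ?q p))"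
      by (simp add: lin_def fsmul_def algebra_simps sum.distrib sum_distrib_left)
    have "T (a, \<phi>) = (\<Sum>p\<in>B \<times> B. ?w p * T (a, ?q p))"
    proof (rule lin_eq_on_tensor[OF is_vspace_scalars lin_eval lin _ T])
      fix x s assume x: "x \<in> carr V" and s: "s \<in> carr ?VV"
      have "\<phi> s = \<phi> (\<Sum>p\<in>B \<times> B. fsmul (s (e (fst p), e (snd p))) (pure V V (fst p) (snd p)))"
        using tensor_coordinates[OF V B(2,3) exp s] by simp
      also have "\<dots> = (\<Sum>p\<in>B \<times> B. \<phi> (fsmul (s (e (fst p), e (snd p))) (pure V V (fst p) (snd p))))"
        using B(2)
        by (intro lin_sum[OF vT is_vspace_scalars dual_lin[OF \<phi>]] scaled_pure_in_tensor) auto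
      also have "\<dots> = (\<Sum>p\<in>B \<times> B. s (e (fst p), e (snd p)) * ?w p)"
        using B(2)
        by (intro sum.cong dual_rules(5)[OF vT \<phi>, unfolded smul_tensor] pure_in_tensor) auto
      finally have "pure V ?VV x s (a, \<phi>) = (\<Sum>p\<in>B \<times> B. ?w p * (a x * s (e (fst p), e (snd p))))"
        by (simp add: pure_eval a \<phi> sum_distrib_left mult_ac)
      also have "\<dots> = (\<Sum>p\<in>B \<times> B. ?w p * pure V ?VV x s (a, ?q p))"
        using B(3) a s by (intro sum.cong) (auto simp: pure_eval tensor_pairing[OF V])
      finally show "pure V ?VV x s (a, \<phi>) = (\<Sum>p\<in>B \<times> B. ?w p * pure V ?VV x s (a, ?q p))" .
    qed
    also have "\<dots> = 0" using 0[OF a] B(3) by (intro sum.neutral) auto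
    finally show ?thesis .
  qed
  then show ?thesis
    using tensor_eqI[OF T vspace_closed(1)[OF is_vspace_tensor]] by simp
qed


section \<open>The bicrossed product of two Lie algebras acting on each other\<close>

definition bicrossed_bracket ::
  "('v::ab_group_add \<Rightarrow> 'v \<Rightarrow> 'v) \<Rightarrow> ('w::ab_group_add \<Rightarrow> 'w \<Rightarrow> 'w) \<Rightarrow>
   ('w \<Rightarrow> 'v \<Rightarrow> 'v) \<Rightarrow> ('v \<Rightarrow> 'w \<Rightarrow> 'w) \<Rightarrow> 'v \<times> 'w \<Rightarrow> 'v \<times> 'w \<Rightarrow> 'v \<times> 'w" where
  "bicrossed_bracket br brV h \<rho> = (\<lambda>(x, a) (y, b).
     (br x y + h a y - h b x, brV a b + \<rho> x b - \<rho> y a))"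

lemma lie_algebra_rules:
  assumes "lie_algebra L br"
  shows "is_vspace L" and "bilin L L L br" and "x \<in> carr L \<Longrightarrow> br x x = 0"
    and "\<lbrakk>x \<in> carr L; y \<in> carr L\<rbrakk> \<Longrightarrow> br x y = - br y x"
    and "\<lbrakk>x \<in> carr L; y \<in> carr L; z \<in> carr L\<rbrakk>
      \<Longrightarrow> br x (br y z) + br y (br z x) + br z (br x y) = 0"
proof -
  show L: "is_vspace L" and br: "bilin L L L br" and alt: "\<And>x. x \<in> carr L \<Longrightarrow> br x x = 0"
    and "\<lbrakk>x \<in> carr L; y \<in> carr L; z \<in> carr L\<rbrakk>
      \<Longrightarrow> br x (br y z) + br y (br z x) + br z (br x y) = 0"
    using assms by (simp_all add: lie_algebra_def)
  note rules = bilin_rules[OF L L L br] vspace_closed[OF L]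
  show "br x y = - br y x" if "x \<in> carr L" "y \<in> carr L"
  proof -
    have "br (x + y) (x + y) = br x x + br x y + br y x + br y y"
      using that by (simp add: rules)
    moreover have "x + y \<in> carr L" using that by (simp add: rules)
    ultimately show ?thesis using that by (simp add: alt eq_neg_iff_add_eq_0)
  qed
qed

lemma dsum_simps [simp]:
  "carr (dsum V W) = carr V \<times> carr W" "smul (dsum V W) c p = (smul V c (fst p), smul W c (snd p))"
  by (simp_all add: dsum_def)

lemma is_vspace_dsum:
  assumes V: "is_vspace V" and W: "is_vspace W"
  shows "is_vspace (dsum V W)"
proof -
  interpret V: vector_space "smul V" using V by (simp add: is_vspace_def)
  interpret W: vector_space "smul W" using W by (simp add: is_vspace_def)
  interpret vector_space "smul (dsum V W)"
    by unfold_locales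
      (auto simp: V.scale_right_distrib W.scale_right_distrib V.scale_left_distrib W.scale_left_distrib)
  show ?thesis
    using vspace_closed[OF V] vspace_closed[OF W]
    by (auto simp: is_vspace_def vector_space_axioms subspace_def zero_prod_def)
qed

text \<open>
  Two Lie algebras that act on each other, with no compatibility between the actions.  The situation
  is symmetric in the two algebras, and the sublocale declaration below makes every statement on the
  first component of \<open>L \<oplus> V\<close> available for the second.
\<close>

locale lie_actions =
  fixes L :: "('k::field, 'v::ab_group_add) vspace" and br
    and V :: "('k, 'w::ab_group_add) vspace" and brV
    and h :: "'w \<Rightarrow> 'v \<Rightarrow> 'v" and \<rho> :: "'v \<Rightarrow> 'w \<Rightarrow> 'w"
  assumes L: "lie_algebra L br" and V: "lie_algebra V brV"
    and \<rho>: "lie_rep L br V \<rho>" and h: "lie_rep V brV L h"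
begin

text \<open>
  The left-hand side of the compatibility condition of a matched pair; the other condition is the
  same expression with the algebras exchanged.
\<close>

definition defect :: "'v \<Rightarrow> 'v \<Rightarrow> 'w \<Rightarrow> 'v" where
  "defect x y c = br y (h c x) - br x (h c y) - h (\<rho> y c) x + h (\<rho> x c) y + h c (br x y)"

lemmas vL = lie_algebra_rules(1)[OF L] and vV = lie_algebra_rules(1)[OF V]

lemma bilin_h: "bilin V L L h" and bilin_\<rho>: "bilin L V V \<rho>"
  using h \<rho> by (simp_all add: lie_rep_def)

lemmas linear_rules = vspace_closed[OF vL] vspace_closed[OF vV]
  vspace_scale[OF vL] vspace_scale[OF vV]
  bilin_rules[OF vL vL vL lie_algebra_rules(2)[OF L]] bilin_rules[OF vV vV vV lie_algebra_rules(2)[OF V]]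
  bilin_rules[OF vV vL vL bilin_h] bilin_rules[OF vL vV vV bilin_\<rho>]

lemma defect_in: "\<lbrakk>x \<in> carr L; y \<in> carr L; c \<in> carr V\<rbrakk> \<Longrightarrow> defect x y c \<in> carr L"
  by (simp add: defect_def linear_rules)

lemma h_brV: "\<lbrakk>a \<in> carr V; b \<in> carr V; x \<in> carr L\<rbrakk> \<Longrightarrow> h (brV a b) x = h a (h b x) - h b (h a x)"
  using h by (simp add: lie_rep_def)

text \<open>
  In the Jacobiator of \<open>x + a\<close>, \<open>y + b\<close>, \<open>z + c\<close> the terms with three elements of \<open>L\<close> cancel by the Jacobi
  identity, those with two elements of \<open>V\<close> and one of \<open>L\<close> cancel because \<open>h\<close> is a representation,
  and the terms with two elements of \<open>L\<close> and one of \<open>V\<close> are left.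
\<close>

lemma jacobiator_fst:
  assumes "x \<in> carr L" "y \<in> carr L" "z \<in> carr L" "a \<in> carr V" "b \<in> carr V" "c \<in> carr V"
  defines "br' \<equiv> bicrossed_bracket br brV h \<rho>"
  shows "fst (br' (x, a) (br' (y, b) (z, c)) + br' (y, b) (br' (z, c) (x, a)) + br' (z, c) (br' (x, a) (y, b)))
    = defect x y c + defect y z a + defect z x b"
proof -
  have "br x (br y z) + br y (br z x) + br z (br x y) = 0"
    using assms(1-3) by (rule lie_algebra_rules(5)[OF L])
  then have jacobi: "br x (br y z) = - br y (br z x) - br z (br x y)"
    by (simp add: eq_neg_iff_add_eq_0 algebra_simps)
  show ?thesis
    using assms(1-6)
    by (simp add: br'_def bicrossed_bracket_def defect_def linear_rules h_brV jacobi)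
qed

lemma defect_0:
  "\<lbrakk>x \<in> carr L; y \<in> carr L\<rbrakk> \<Longrightarrow> defect x y 0 = 0"
  "\<lbrakk>x \<in> carr L; c \<in> carr V\<rbrakk> \<Longrightarrow> defect x 0 c = 0"
  "\<lbrakk>x \<in> carr L; c \<in> carr V\<rbrakk> \<Longrightarrow> defect 0 x c = 0"
  by (simp_all add: defect_def linear_rules)

lemma bilin_bicrossed:
  "bilin (dsum L V) (dsum L V) (dsum L V) (bicrossed_bracket br brV h \<rho>)"
  by (auto simp: bilin_def lin_def bicrossed_bracket_def linear_rules algebra_simps)

end

sublocale lie_actions \<subseteq> swap: lie_actions V brV L br \<rho> h
  by unfold_locales (fact V L h \<rho>)+

context lie_actions
begin

text \<open>
  The exchange of the components carries the bracket of \<open>L \<oplus> V\<close> to that of \<open>V \<oplus> L\<close>, so the second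
  component is the first one of the exchanged pair.
\<close>

lemma jacobiator:
  assumes "x \<in> carr L" "y \<in> carr L" "z \<in> carr L" "a \<in> carr V" "b \<in> carr V" "c \<in> carr V"
  defines "br' \<equiv> bicrossed_bracket br brV h \<rho>"
  shows "br' (x, a) (br' (y, b) (z, c)) + br' (y, b) (br' (z, c) (x, a)) + br' (z, c) (br' (x, a) (y, b))
    = (defect x y c + defect y z a + defect z x b, swap.defect a b z + swap.defect b c x + swap.defect c a y)"
    (is "?J = _")
proof (rule prod_eqI)
  show "fst ?J = fst (defect x y c + defect y z a + defect z x b,
      swap.defect a b z + swap.defect b c x + swap.defect c a y)"
    using jacobiator_fst[OF assms(1-6)] by (simp add: br'_def)
  have "snd ?J = fst (prod.swap ?J)" by simp
  also have "prod.swap ?J = bicrossed_bracket brV br \<rho> h (a, x) (bicrossed_bracket brV br \<rho> h (b, y) (c, z))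
      + bicrossed_bracket brV br \<rho> h (b, y) (bicrossed_bracket brV br \<rho> h (c, z) (a, x))
      + bicrossed_bracket brV br \<rho> h (c, z) (bicrossed_bracket brV br \<rho> h (a, x) (b, y))"
    by (simp add: br'_def bicrossed_bracket_def)
  also have "fst \<dots> = swap.defect a b z + swap.defect b c x + swap.defect c a y"
    by (rule swap.jacobiator_fst[OF assms(4-6,1-3)])
  finally show "snd ?J = snd (defect x y c + defect y z a + defect z x b,
      swap.defect a b z + swap.defect b c x + swap.defect c a y)" by simp
qed

lemma matched_pair_lie_iff_defect:
  "matched_pair_lie L br V brV h \<rho> \<longleftrightarrow>
     (\<forall>x\<in>carr L. \<forall>y\<in>carr L. \<forall>c\<in>carr V. defect x y c = 0)
     \<and> (\<forall>z\<in>carr L. \<forall>a\<in>carr V. \<forall>b\<in>carr V. swap.defect a b z = 0)"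
  using L V \<rho> h by (simp add: matched_pair_lie_def defect_def swap.defect_def)

text \<open>
  For \<open>a = b = 0\<close>, \<open>z = 0\<close> only one defect of \<open>L\<close> is left in the Jacobiator, and for \<open>x = y = 0\<close>,
  \<open>c = 0\<close> only one of \<open>V\<close>, so the Jacobi identity forces each of them to vanish.
\<close>

theorem lie_algebra_bicrossed_iff:
  "lie_algebra (dsum L V) (bicrossed_bracket br brV h \<rho>) \<longleftrightarrow> matched_pair_lie L br V brV h \<rho>"
    (is "lie_algebra ?M ?br \<longleftrightarrow> _")
proof
  assume "lie_algebra ?M ?br"
  then have "defect x y c + defect y z a + defect z x b = 0
      \<and> swap.defect a b z + swap.defect b c x + swap.defect c a y = 0"
    if "x \<in> carr L" "y \<in> carr L" "z \<in> carr L" "a \<in> carr V" "b \<in> carr V" "c \<in> carr V" for x y z a b c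
    using lie_algebra_rules(5)[of ?M ?br "(x, a)" "(y, b)" "(z, c)"] jacobiator[OF that] that
    by (simp add: zero_prod_def)
  from this[of _ _ 0 0 0] this[of 0 0 _ _ _ 0] show "matched_pair_lie L br V brV h \<rho>"
    by (simp add: matched_pair_lie_iff_defect linear_rules defect_0 swap.defect_0)
next
  assume "matched_pair_lie L br V brV h \<rho>"
  then have "defect x y c = 0" "swap.defect a b z = 0"
    if "x \<in> carr L" "y \<in> carr L" "z \<in> carr L" "a \<in> carr V" "b \<in> carr V" "c \<in> carr V" for x y z a b c
    using that by (simp_all add: matched_pair_lie_iff_defect)
  then have "?br u (?br v w) + ?br v (?br w u) + ?br w (?br u v) = 0"
    if "u \<in> carr ?M" "v \<in> carr ?M" "w \<in> carr ?M" for u v w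
    using that by (auto simp: jacobiator zero_prod_def)
  moreover have "?br u u = 0" if "u \<in> carr ?M" for u
    using that lie_algebra_rules(3)[OF L] lie_algebra_rules(3)[OF V]
    by (auto simp: bicrossed_bracket_def zero_prod_def)
  ultimately show "lie_algebra ?M ?br"
    by (simp add: lie_algebra_def is_vspace_dsum vL vV bilin_bicrossed)
qed

text \<open>
  The Leibniz defect of \<open>d + \<xi>\<close> on \<open>L \<oplus> V\<close> is likewise a combination of the defects of \<open>d\<close> and \<open>\<xi>\<close>, which
  vanish, and of those of the two mixed terms \<open>h a y\<close> and \<open>\<rho> x b\<close>; the latter vanish exactly if the
  actions are representations of differential Lie algebras.
\<close>

theorem diff_lie_algebra_bicrossed_iff:
  assumes d: "diff_lie_algebra lam L br d" and \<xi>: "diff_lie_algebra lam V brV \<xi>"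
  shows "diff_lie_algebra lam (dsum L V) (bicrossed_bracket br brV h \<rho>) (map_prod d \<xi>)
    \<longleftrightarrow> matched_pair_diff_lie lam L br d V brV \<xi> h \<rho>"
proof -
  let ?M = "dsum L V" and ?br = "bicrossed_bracket br brV h \<rho>" and ?d = "map_prod d \<xi>"
  have lin_d: "lin L L d" "lin V V \<xi>" using d \<xi> by (simp_all add: diff_lie_algebra_def)
  note rules = linear_rules lin_rules[OF vL vL lin_d(1)] lin_rules[OF vV vV lin_d(2)]
  let ?E = "\<lambda>a y. h (\<xi> a) y + h a (d y) + smul L lam (h (\<xi> a) (d y))"
  let ?F = "\<lambda>x b. \<rho> (d x) b + \<rho> x (\<xi> b) + smul V lam (\<rho> (d x) (\<xi> b))"
  have lin_M: "lin ?M ?M ?d" by (auto simp: lin_def rules)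
  have leibniz: "?d (?br (x, a) (y, b)) - (?br (?d (x, a)) (y, b) + ?br (x, a) (?d (y, b))
        + smul ?M lam (?br (?d (x, a)) (?d (y, b))))
      = ((d (h a y) - ?E a y) - (d (h b x) - ?E b x), (\<xi> (\<rho> x b) - ?F x b) - (\<xi> (\<rho> y a) - ?F y a))"
    if "x \<in> carr L" "y \<in> carr L" "a \<in> carr V" "b \<in> carr V" for x y a b
    using that d \<xi> by (simp add: bicrossed_bracket_def rules diff_lie_algebra_def)
  show ?thesis
  proof
    assume M: "diff_lie_algebra lam ?M ?br ?d"
    have mixed: "d (h a y) - ?E a y - (d (h b x) - ?E b x) = 0 \<and> \<xi> (\<rho> x b) - ?F x b - (\<xi> (\<rho> y a) - ?F y a) = 0"
      if "x \<in> carr L" "y \<in> carr L" "a \<in> carr V" "b \<in> carr V" for x y a b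
    proof -
      have "(x, a) \<in> carr ?M" "(y, b) \<in> carr ?M" using that by simp_all
      with M have "?d (?br (x, a) (y, b)) = ?br (?d (x, a)) (y, b) + ?br (x, a) (?d (y, b))
          + smul ?M lam (?br (?d (x, a)) (?d (y, b)))"
        unfolding diff_lie_algebra_def by blast
      then show ?thesis
        using leibniz[OF that] by (simp only: right_minus_eq[THEN iffD2] zero_prod_def prod.inject)
    qed
    have "d (h a y) = ?E a y" "\<xi> (\<rho> y a) = ?F y a" if "y \<in> carr L" "a \<in> carr V" for y a
      using mixed[OF vspace_closed(1)[OF vL] that vspace_closed(1)[OF vV]] that by (simp_all add: rules)
    moreover have "matched_pair_lie L br V brV h \<rho>"
      using M lie_algebra_bicrossed_iff by (simp add: diff_lie_algebra_def)
    ultimately show "matched_pair_diff_lie lam L br d V brV \<xi> h \<rho>"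
      using d \<xi> h \<rho> lin_d
      unfolding matched_pair_diff_lie_def diff_lie_rep_def by blast
  next
    assume P: "matched_pair_diff_lie lam L br d V brV \<xi> h \<rho>"
    then have EF: "d (h a y) - ?E a y = 0" "\<xi> (\<rho> y a) - ?F y a = 0" if "y \<in> carr L" "a \<in> carr V" for y a
      using that by (simp_all add: matched_pair_diff_lie_def diff_lie_rep_def)
    have "?d (?br u v) = ?br (?d u) v + ?br u (?d v) + smul ?M lam (?br (?d u) (?d v))"
      if "u \<in> carr ?M" "v \<in> carr ?M" for u v
    proof -
      obtain x a y b where uv: "u = (x, a)" "v = (y, b)" by (meson surj_pair)
      with that have xy: "x \<in> carr L" "y \<in> carr L" and ab: "a \<in> carr V" "b \<in> carr V" by auto
      show ?thesis
        using leibniz[OF xy ab]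
        unfolding uv EF[OF xy(1) ab(1)] EF[OF xy(1) ab(2)] EF[OF xy(2) ab(1)] EF[OF xy(2) ab(2)]
        by (simp only: diff_0_right zero_prod_def[symmetric] right_minus_eq)
    qed
    moreover have "lie_algebra ?M ?br"
      using P lie_algebra_bicrossed_iff by (simp add: matched_pair_diff_lie_def)
    ultimately show "diff_lie_algebra lam ?M ?br ?d"
      using lin_M by (simp only: diff_lie_algebra_def) blast
  qed
qed

end


section \<open>The coadjoint actions of a Lie algebra and its dual\<close>

text \<open>
  For zero maps in place of the differential and of \<open>\<pi>\<close>, the pointwise criterion of admissibility holds
  trivially; what remains of admissibility is that the coadjoint action is a representation.
\<close>

lemma lie_rep_coad:
  assumes "lie_algebra L br"
  shows "lie_rep L br (dual L) (coad L br)"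
proof -
  note rules = lie_algebra_rules[OF assms]
  have "lin L L (\<lambda>x. 0)" and "diff_lie_algebra 0 L br (\<lambda>x. 0)"
    using assms vspace_closed(1)[OF rules(1)] vspace_scale(1)[OF rules(1)]
      bilin_rules[OF rules(1,1,1,2)]
    by (simp_all add: diff_lie_algebra_def lin_def)
  moreover have "\<forall>x\<in>carr L. \<forall>y\<in>carr L. br x 0 = br 0 y + 0 + smul L 0 0"
    using bilin_rules(2,3)[OF rules(1,1,1,2)] vspace_scale(1)[OF rules(1)] by simp
  ultimately have "adjoint_admissible 0 L br (\<lambda>x. 0) (\<lambda>x. 0)"
    using adjoint_admissible_iff[of 0 L br "\<lambda>x. 0" "\<lambda>x. 0"] by simp
  then show ?thesis by (simp add: adjoint_admissible_def diff_lie_rep_def)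
qed

locale dual_lie_algebras =
  fixes L :: "('k::field, 'v::ab_group_add) vspace" and br :: "'v \<Rightarrow> 'v \<Rightarrow> 'v"
    and brs :: "('v \<Rightarrow> 'k) \<Rightarrow> ('v \<Rightarrow> 'k) \<Rightarrow> ('v \<Rightarrow> 'k)"
  assumes fin: "fin_dim L" and lie: "lie_algebra L br" and lie_dual: "lie_algebra (dual L) brs"
begin

abbreviation (input) h where "h \<equiv> coad_dual L brs"
abbreviation (input) \<rho> where "\<rho> \<equiv> coad L br"

lemmas vL = lie_algebra_rules(1)[OF lie] and vD = lie_algebra_rules(1)[OF lie_dual]

lemmas rules = vspace_closed[OF vL] vspace_closed[OF vD, unfolded smul_dual] vspace_scale[OF vL]
  bilin_rules[OF vL vL vL lie_algebra_rules(2)[OF lie]]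
  bilin_rules[OF vD vD vD lie_algebra_rules(2)[OF lie_dual], unfolded smul_dual]

lemma fsmul_apply [simp]: "fsmul c f x = c * f x"
  by (simp add: fsmul_def)

lemma h_spec:
  assumes "a \<in> carr (dual L)" "x \<in> carr L"
  shows "h a x \<in> carr L" and "b \<in> carr (dual L) \<Longrightarrow> b (h a x) = - brs a b x"
proof -
  have "lin (dual L) scalars (\<lambda>b. - brs a b x)"
    using assms by (simp add: lin_def rules)
  from theI'[OF dual_reflexive[OF vL fin this], folded coad_dual_def]
  show "h a x \<in> carr L" and "b \<in> carr (dual L) \<Longrightarrow> b (h a x) = - brs a b x"
    by blast+
qed

lemma \<rho>_spec:
  assumes "x \<in> carr L" "b \<in> carr (dual L)"
  shows "\<rho> x b \<in> carr (dual L)" and "y \<in> carr L \<Longrightarrow> \<rho> x b y = - b (br x y)"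
proof -
  have "bilin L (dual L) (dual L) \<rho>" using lie_rep_coad[OF lie] by (simp add: lie_rep_def)
  then show "\<rho> x b \<in> carr (dual L)" using assms by (simp add: bilin_def lin_def)
  show "y \<in> carr L \<Longrightarrow> \<rho> x b y = - b (br x y)" by (simp add: coad_def)
qed

lemma anti: "\<lbrakk>x \<in> carr L; y \<in> carr L\<rbrakk> \<Longrightarrow> br x y = - br y x"
  and anti_dual: "\<lbrakk>a \<in> carr (dual L); b \<in> carr (dual L)\<rbrakk> \<Longrightarrow> brs a b = - brs b a"
  by (fact lie_algebra_rules(4)[OF lie], fact lie_algebra_rules(4)[OF lie_dual])

text \<open>
  This is the coadjoint representation of \<open>L\<^sup>*\<close> transported from the bidual to \<open>L\<close>: after pairing with
  a functional \<open>c\<close>, the representation property is the Jacobi identity of \<open>a\<close>, \<open>b\<close>, \<open>c\<close>.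
\<close>

lemma lie_rep_coad_dual: "lie_rep (dual L) brs L h"
  unfolding lie_rep_def bilin_def
proof (intro conjI ballI)
  fix a assume a: "a \<in> carr (dual L)"
  show "lin L L (h a)" unfolding lin_def
    using a by (auto intro!: eq_if_dual_eq[OF vL] simp: h_spec rules dual_rules[OF vL])
  fix x assume x: "x \<in> carr L"
  fix b assume b: "b \<in> carr (dual L)"
  show "h (brs a b) x = h a (h b x) - h b (h a x)"
  proof (rule eq_if_dual_eq[OF vL])
    fix c assume c: "c \<in> carr (dual L)"
    have "brs a (brs b c) + brs b (brs c a) + brs c (brs a b) = 0"
      using a b c by (rule lie_algebra_rules(5)[OF lie_dual])
    then have "brs a (brs b c) x + brs b (brs c a) x + brs c (brs a b) x = 0"
      by (metis plus_fun_apply zero_fun_apply)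
    moreover have "brs b (brs c a) = - brs b (brs a c)"
      using anti_dual[OF c a] a b c by (simp add: rules)
    moreover have "brs c (brs a b) = - brs (brs a b) c"
      by (rule anti_dual) (simp_all add: a b c rules)
    ultimately have "brs (brs a b) c x = brs a (brs b c) x - brs b (brs a c) x"
      by (simp add: algebra_simps)
    then show "c (h (brs a b) x) = c (h a (h b x) - h b (h a x))"
      using a b c x by (simp add: h_spec rules dual_rules[OF vL])
  qed (use a b x in \<open>simp_all add: h_spec rules\<close>)
next
  fix x assume x: "x \<in> carr L"
  show "lin (dual L) L (\<lambda>a. h a x)" unfolding lin_def
    using x by (auto intro!: eq_if_dual_eq[OF vL] simp: h_spec rules dual_rules[OF vL])
qed (rule vL)

sublocale lie_actions L br "dual L" brs h \<rho>
  by unfold_locales (fact lie lie_dual lie_rep_coad[OF lie] lie_rep_coad_dual)+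

text \<open>
  The condition that the cobracket \<open>\<delta>\<close> is a 1-cocycle, paired with \<open>a \<otimes> b\<close>.  The
  transpose of \<open>[x, -]\<close> is \<open>- \<rho> x\<close>, so here the terms with \<open>\<rho> x\<close> are the negative ones.
\<close>

definition cocycle :: bool where
  "cocycle \<longleftrightarrow> (\<forall>x\<in>carr L. \<forall>y\<in>carr L. \<forall>a\<in>carr (dual L). \<forall>b\<in>carr (dual L).
     brs a b (br x y) = brs (\<rho> y a) b x + brs a (\<rho> y b) x - brs (\<rho> x a) b y - brs a (\<rho> x b) y)"

text \<open>
  Both compatibility conditions of a matched pair become the cocycle condition when they are paired
  with the argument that is missing: the first with \<open>b\<close> in \<open>L\<^sup>*\<close>, the second with \<open>y\<close> in \<open>L\<close>.
\<close>

lemma defect_pairing: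
  assumes x: "x \<in> carr L" "y \<in> carr L" and a: "a \<in> carr (dual L)" "b \<in> carr (dual L)"
  defines "r \<equiv> brs (\<rho> y a) b x + brs a (\<rho> y b) x - brs (\<rho> x a) b y - brs a (\<rho> x b) y"
  shows "b (defect x y a) = r - brs a b (br x y)"
    and "swap.defect a b x y = r - brs a b (br x y)"
proof -
  \<comment> \<open>Both sides are \<open>- \<langle>\<rho> u c, h e v\<rangle>\<close>, by the definitions of the two coadjoint actions.\<close>
  have move: "c (br u (h e v)) = brs e (\<rho> u c) v"
    if "u \<in> carr L" "v \<in> carr L" "c \<in> carr (dual L)" "e \<in> carr (dual L)" for u v c e
    using that \<rho>_spec(2)[of u c "h e v"] h_spec(2)[of e v "\<rho> u c"] \<rho>_spec(1) h_spec(1) by simp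
  show "b (defect x y a) = r - brs a b (br x y)"
    using x a by (simp add: defect_def r_def dual_rules[OF vL] rules h_spec \<rho>_spec move)
  have "brs b (\<rho> x a) = - brs (\<rho> x a) b"
    by (rule anti_dual) (simp_all add: x a \<rho>_spec)
  moreover have "a (br (h b x) y) = - brs b (\<rho> y a) x" "b (br (h a x) y) = - brs a (\<rho> y b) x"
    using anti[of "h b x" y] anti[of "h a x" y] x a move
    by (simp_all add: dual_rules[OF vL] rules h_spec)
  moreover have "brs b (\<rho> y a) = - brs (\<rho> y a) b"
    by (rule anti_dual) (simp_all add: x a \<rho>_spec)
  ultimately show "swap.defect a b x y = r - brs a b (br x y)"
    using x a by (simp add: swap.defect_def r_def rules h_spec \<rho>_spec)
qed

theorem matched_pair_iff_cocycle: "matched_pair_lie L br (dual L) brs h \<rho> \<longleftrightarrow> cocycle"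
proof
  assume P: "matched_pair_lie L br (dual L) brs h \<rho>"
  show cocycle
    unfolding cocycle_def
  proof (intro ballI)
    fix x y a b
    assume xy: "x \<in> carr L" "y \<in> carr L" and ab: "a \<in> carr (dual L)" "b \<in> carr (dual L)"
    have "defect x y a = 0" using P xy ab by (simp add: matched_pair_lie_iff_defect)
    then show "brs a b (br x y)
        = brs (\<rho> y a) b x + brs a (\<rho> y b) x - brs (\<rho> x a) b y - brs a (\<rho> x b) y"
      using defect_pairing(1)[OF xy ab] dual_rules(1)[OF vL ab(2)] by simp
  qed
next
  assume cocycle
  then have 0: "b (defect x y a) = 0" "swap.defect a b x y = 0"
    if "x \<in> carr L" "y \<in> carr L" "a \<in> carr (dual L)" "b \<in> carr (dual L)" for x y a b
    using defect_pairing[OF that] that by (simp_all add: cocycle_def)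
  have "defect x y a = 0" if "x \<in> carr L" "y \<in> carr L" "a \<in> carr (dual L)" for x y a
    by (rule eq_if_dual_eq[OF vL])
      (use that in \<open>simp_all add: 0 defect_in dual_rules(1)[OF vL] rules(1)\<close>)
  moreover have "swap.defect a b x = 0"
    if "x \<in> carr L" "a \<in> carr (dual L)" "b \<in> carr (dual L)" for x a b
  proof (rule dual_eqI)
    show "swap.defect a b x \<in> carr (dual L)" "0 \<in> carr (dual L)"
      using that by (simp_all add: swap.defect_in rules)
    show "swap.defect a b x y = 0 y" if y: "y \<in> carr L" for y
      using 0(2)[OF \<open>x \<in> _\<close> y \<open>a \<in> _\<close> \<open>b \<in> _\<close>] by simp
  qed
  ultimately show "matched_pair_lie L br (dual L) brs h \<rho>"
    by (simp add: matched_pair_lie_iff_defect)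
qed

text \<open>
  By definition, admissibility of \<open>d\<^sup>*\<close> concerns the coadjoint action of \<open>L\<^sup>*\<close> on its own dual, the
  bidual of \<open>L\<close>.  Pairing the representation condition on \<open>L\<close> with \<open>b\<close> yields the pointwise form of
  admissibility, so that the bidual need not be identified with \<open>L\<close>.
\<close>

lemma diff_lie_rep_coad_dual_iff:
  assumes d: "lin L L d" and D: "diff_lie_algebra lam (dual L) brs (dual_map L D)"
  shows "diff_lie_rep lam (dual L) brs (dual_map L D) L h d
    \<longleftrightarrow> adjoint_admissible lam (dual L) brs (dual_map L D) (dual_map L d)"
proof -
  let ?d = "dual_map L d" and ?D = "dual_map L D"
  have lin_d: "lin (dual L) (dual L) ?d" by (rule lin_dual_map[OF d vL])
  have lin_D: "lin (dual L) (dual L) ?D" using D by (simp add: diff_lie_algebra_def)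
  note lins = lin_rules[OF vL vL d] lin_rules(1)[OF vD vD lin_d] lin_rules(1)[OF vD vD lin_D]
  have d_apply: "?d b x = b (d x)" if "x \<in> carr L" for b x
    using that by (simp add: dual_map_def)
  let ?l = "\<lambda>a b. brs a (?d b)"
  let ?r = "\<lambda>a b. brs (?D a) b + ?d (brs a b) + fsmul lam (?d (brs (?D a) b))"
  have pairing: "b (d (h a x)) = - ?l a b x"
    "b (h (?D a) x + h a (d x) + smul L lam (h (?D a) (d x))) = - ?r a b x"
    if "a \<in> carr (dual L)" "b \<in> carr (dual L)" "x \<in> carr L" for a b x
  proof -
    show "b (d (h a x)) = - ?l a b x"
      using that h_spec(2)[of a x "?d b"] h_spec(1)[of a x] by (simp only: d_apply lins)
    show "b (h (?D a) x + h a (d x) + smul L lam (h (?D a) (d x))) = - ?r a b x"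
      using that by (simp add: d_apply lins h_spec rules dual_rules[OF vL] algebra_simps)
  qed
  have "(d (h a x) = h (?D a) x + h a (d x) + smul L lam (h (?D a) (d x)))
      \<longleftrightarrow> (\<forall>b\<in>carr (dual L). ?l a b x = ?r a b x)"
    (is "?p = ?q \<longleftrightarrow> _")
    if a: "a \<in> carr (dual L)" and x: "x \<in> carr L" for a x
  proof (intro iffI ballI)
    fix b assume "?p = ?q" and b: "b \<in> carr (dual L)"
    then have "- ?l a b x = - ?r a b x" using pairing[OF a b x] by (simp only:)
    then show "?l a b x = ?r a b x" by (simp only: neg_equal_iff_equal)
  next
    assume eq: "\<forall>b\<in>carr (dual L). ?l a b x = ?r a b x"
    show "?p = ?q"
    proof (rule eq_if_dual_eq[OF vL])
      fix b assume b: "b \<in> carr (dual L)"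
      have "- ?l a b x = - ?r a b x" using eq b by (simp only:)
      then show "b ?p = b ?q" using pairing[OF a b x] by (simp only:)
    qed (use a x in \<open>simp_all add: lins h_spec rules\<close>)
  qed
  then have "diff_lie_rep lam (dual L) brs ?D L h d
      \<longleftrightarrow> (\<forall>a\<in>carr (dual L). \<forall>x\<in>carr L. \<forall>b\<in>carr (dual L). ?l a b x = ?r a b x)"
    unfolding diff_lie_rep_def using lie_rep_coad_dual d by blast
  also have "\<dots> \<longleftrightarrow> (\<forall>a\<in>carr (dual L). \<forall>b\<in>carr (dual L). ?l a b = ?r a b)"
  proof (intro iffI ballI)
    fix a b
    assume eq: "\<forall>a\<in>carr (dual L). \<forall>x\<in>carr L. \<forall>b\<in>carr (dual L). ?l a b x = ?r a b x"
      and a: "a \<in> carr (dual L)" and b: "b \<in> carr (dual L)"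
    show "?l a b = ?r a b"
    proof (rule dual_eqI)
      have "fsmul lam (?d (brs (?D a) b)) \<in> carr (dual L)"
        using vspace_closed(5)[OF vD, of "?d (brs (?D a) b)" lam] a b by (simp add: lins rules)
      then show "?r a b \<in> carr (dual L)" "?l a b \<in> carr (dual L)"
        using a b by (simp_all only: lins rules)
    qed (use eq a b in blast)
  next
    fix a x b
    assume "\<forall>a\<in>carr (dual L). \<forall>b\<in>carr (dual L). ?l a b = ?r a b"
      and "a \<in> carr (dual L)" and "b \<in> carr (dual L)"
    then show "?l a b x = ?r a b x" by simp
  qed
  also have "\<dots> \<longleftrightarrow> adjoint_admissible lam (dual L) brs ?D ?d"
    using adjoint_admissible_iff[OF D lin_d] by simp
  finally show ?thesis .
qed

end


section \<open>Manin triples\<close>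

context dual_lie_algebras
begin

lemma double_bracket_eq: "double_bracket L br brs = bicrossed_bracket br brs h \<rho>"
  by (simp add: double_bracket_def bicrossed_bracket_def)

text \<open>
  The mixed terms of the bracket are built to make this hold: both sides are the sum of the cyclic
  permutations of \<open>\<langle>[x, y], c\<rangle>\<close> and of \<open>\<langle>[a, b], z\<rangle>\<close>.
\<close>

lemma double_form_invariant:
  assumes "u \<in> carr (dsum L (dual L))" "v \<in> carr (dsum L (dual L))" "w \<in> carr (dsum L (dual L))"
  shows "double_form (double_bracket L br brs u v) w = double_form u (double_bracket L br brs v w)"
proof -
  obtain x a y b z c where uvw: "u = (x, a)" "v = (y, b)" "w = (z, c)" by (meson surj_pair)
  with assms have x: "x \<in> carr L" "y \<in> carr L" "z \<in> carr L"
    and a: "a \<in> carr (dual L)" "b \<in> carr (dual L)" "c \<in> carr (dual L)" by auto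
  have "c (br x y) = - c (br y x)" "b (br x z) = - b (br z x)"
    using anti[of x y] anti[of x z] x a by (simp_all add: rules dual_rules[OF vL])
  moreover have "brs a b z = - brs b a z" "brs a c y = - brs c a y"
    using anti_dual[of a b] anti_dual[of a c] a by simp_all
  ultimately show ?thesis
    using x a unfolding uvw double_bracket_def double_form_def
    by (simp add: h_spec \<rho>_spec rules dual_rules[OF vL])
qed

lemma nondegenerate_double_form: "nondegenerate_symmetric (dsum L (dual L)) double_form"
  unfolding nondegenerate_symmetric_def
proof (intro conjI ballI impI)
  show "bilin (dsum L (dual L)) (dsum L (dual L)) scalars double_form"
    by (auto simp: bilin_def lin_def double_form_def dual_rules[OF vL] algebra_simps)
  show "double_form u v = double_form v u" for u v :: "'v \<times> ('v \<Rightarrow> 'k)"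
    by (simp add: double_form_def add.commute split: prod.split)
  fix u assume u: "u \<in> carr (dsum L (dual L))"
    and 0: "\<forall>v\<in>carr (dsum L (dual L)). double_form u v = 0"
  obtain x a where xa: "u = (x, a)" by (cases u)
  with u have x: "x \<in> carr L" and a: "a \<in> carr (dual L)" by auto
  have "x = 0"
  proof (rule dual_separates[OF vL x], rule ballI)
    fix b assume b: "b \<in> carr (dual L)"
    then show "b x = 0"
      using bspec[OF 0, of "(0, b)"] rules(1) by (simp add: xa double_form_def dual_rules(1)[OF vL a])
  qed
  moreover have "a = 0"
  proof (rule dual_eqI[OF a vspace_closed(1)[OF vD]])
    fix y assume y: "y \<in> carr L"
    then show "a y = 0 y"
      using bspec[OF 0, of "(y, 0)"] vspace_closed(1)[OF vD] by (simp add: xa double_form_def)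
  qed
  ultimately show "u = 0" by (simp add: xa zero_prod_def)
qed

text \<open>
  Invariance and nondegeneracy of the form and the inclusions of \<open>L\<close> and \<open>L\<^sup>*\<close> as subalgebras hold for
  any two brackets, so a Manin triple amounts to the structure of a differential Lie algebra on
  \<open>L \<oplus> L\<^sup>*\<close>, which is the bicrossed product.
\<close>

theorem manin_triple_iff_matched_pair:
  assumes d: "diff_lie_algebra lam L br d" and ds: "diff_lie_algebra lam (dual L) brs ds"
  shows "manin_triple lam L br d brs ds
    \<longleftrightarrow> matched_pair_diff_lie lam L br d (dual L) brs ds h \<rho>"
proof -
  let ?M = "dsum L (dual L)" and ?br = "double_bracket L br brs" and ?d = "map_prod d ds"
  have lins: "lin L L d" "lin (dual L) (dual L) ds" using d ds by (simp_all add: diff_lie_algebra_def)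
  have 0: "d 0 = 0" "ds 0 = 0"
    by (fact lin_rules(2)[OF vL vL lins(1)], fact lin_rules(2)[OF vD vD lins(2)])
  have "diff_lie_subalgebra lam L br d (\<lambda>x. (x, 0)) ?M ?br ?d" if "diff_lie_algebra lam ?M ?br ?d"
    using that d 0 vspace_scale(1)[OF vD, unfolded smul_dual]
    by (simp add: linear_rules diff_lie_subalgebra_def double_bracket_eq bicrossed_bracket_def lin_def inj_on_def)
  moreover have "diff_lie_subalgebra lam (dual L) brs ds (\<lambda>a. (0, a)) ?M ?br ?d"
    if "diff_lie_algebra lam ?M ?br ?d"
    using that ds 0
    by (simp add: linear_rules diff_lie_subalgebra_def double_bracket_eq bicrossed_bracket_def lin_def inj_on_def)
  ultimately have "manin_triple lam L br d brs ds \<longleftrightarrow> diff_lie_algebra lam ?M ?br ?d"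
    using nondegenerate_double_form double_form_invariant
    unfolding manin_triple_def Let_def by blast
  also have "\<dots> \<longleftrightarrow> matched_pair_diff_lie lam L br d (dual L) brs ds h \<rho>"
    unfolding double_bracket_eq by (rule diff_lie_algebra_bicrossed_iff[OF d ds])
  finally show ?thesis .
qed

end


section \<open>The cobracket dual to the bracket on the dual space\<close>

lemma lie_algebra_cong:
  assumes "lie_algebra L br" and "\<And>x y. \<lbrakk>x \<in> carr L; y \<in> carr L\<rbrakk> \<Longrightarrow> br' x y = br x y"
  shows "lie_algebra L br'"
proof -
  note rules = lie_algebra_rules[OF assms(1)]
  note closed = bilin_rules(1)[OF rules(1,1,1,2)] vspace_closed[OF rules(1)]
  have "bilin L L L br'"
    using rules(2) by (simp add: bilin_def lin_def assms(2) closed)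
  then show ?thesis
    using assms(1) by (simp add: lie_algebra_def assms(2) closed)
qed

locale comultiplication = dual_lie_algebras L br brs
  for L :: "('k::field, 'v::ab_group_add) vspace" and br brs +
  fixes \<delta> :: "'v \<Rightarrow> (('v \<Rightarrow> 'k) \<times> ('v \<Rightarrow> 'k) \<Rightarrow> 'k)"
  assumes lin_\<delta>: "lin L (tensor L L) \<delta>"
    and brs: "\<lbrakk>a \<in> carr (dual L); b \<in> carr (dual L); x \<in> carr L\<rbrakk>
      \<Longrightarrow> brs a b x = tensor_pairing L a b (\<delta> x)"
begin

lemma \<delta>_in: "x \<in> carr L \<Longrightarrow> \<delta> x \<in> carr (tensor L L)"
  using lin_\<delta> by (simp add: lin_def)

lemma \<delta>_eval: "\<lbrakk>a \<in> carr (dual L); b \<in> carr (dual L); x \<in> carr L\<rbrakk> \<Longrightarrow> \<delta> x (a, b) = brs a b x"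
  by (simp add: brs tensor_pairing(2)[OF vL] \<delta>_in)

lemma dual_bracket_eq:
  "\<lbrakk>a \<in> carr (dual L); b \<in> carr (dual L)\<rbrakk> \<Longrightarrow> dual_bracket L \<delta> a b = brs a b"
  using dual_outside[of "brs a b" L] by (auto simp: dual_bracket_def brs rules)

lemma dual_map_id: "a \<in> carr (dual L) \<Longrightarrow> dual_map L id a = a"
  using dual_outside[of a L] by (auto simp: dual_map_def)

lemma tensor_map_\<delta>:
  assumes "lin L L f" "lin L L g" "x \<in> carr L" "a \<in> carr (dual L)" "b \<in> carr (dual L)"
  shows "tensor_map L L L L f g (\<delta> x) (a, b) = brs (dual_map L f a) (dual_map L g b) x"
  using tensor_map(2)[OF vL vL vL vL assms(1,2,4,5) \<delta>_in[OF assms(3)]]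
    \<delta>_eval[OF dual_map_in[OF assms(1,4) vL] dual_map_in[OF assms(2,5) vL] assms(3)]
  by (simp only:)

lemma tensor_map_in:
  assumes "lin L L f" "lin L L g" "x \<in> carr L"
  shows "tensor_map L L L L f g (\<delta> x) \<in> carr (tensor L L)"
  using tensor_map(1)[OF vL vL vL vL assms(1,2)] \<delta>_in[OF assms(3)] by (simp add: lin_def)

text \<open>
  The coalgebra axioms are the transposed axioms of the Lie algebra \<open>L\<^sup>*\<close>: \<open>[a, a] = 0\<close> says that \<open>\<delta> x\<close>
  is alternating, and the value of \<open>(id \<otimes> \<delta>) (\<delta> x)\<close> at \<open>a \<otimes> (b \<otimes> c)\<close> is \<open>\<langle>[a, [b, c]], x\<rangle>\<close>, whose
  cyclic sum vanishes by the Jacobi identity.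
\<close>

lemma lie_coalgebra_\<delta>: "lie_coalgebra L \<delta>"
  unfolding lie_coalgebra_def Let_def
proof (intro conjI ballI)
  let ?LL = "tensor L L" and ?LLL = "tensor L (tensor L L)"
  fix x assume x: "x \<in> carr L"
  show "\<exists>t\<in>carr ?LL. \<delta> x = t - flip L t"
  proof (rule alternating_tensor[OF vL fin \<delta>_in[OF x]])
    show "\<delta> x (a, a) = 0" if "a \<in> carr (dual L)" for a
      using that x lie_algebra_rules(3)[OF lie_dual that] by (simp add: \<delta>_eval)
    show "\<delta> x (a, b) = - \<delta> x (b, a)" if "a \<in> carr (dual L)" "b \<in> carr (dual L)" for a b
      using that x anti_dual[OF that] by (simp add: \<delta>_eval)
  qed
  define t where "t = tensor_map L L L ?LL id \<delta> (\<delta> x)"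
  note T = tensor_map[OF vL vL vL is_vspace_tensor lin_id lin_\<delta>]
  have t: "t \<in> carr ?LLL" using T(1) \<delta>_in[OF x] by (simp add: t_def lin_def)
  have c: "cyc L s \<in> carr ?LLL" if "s \<in> carr ?LLL" for s
    using cyc(1)[OF vL] that by (simp add: lin_def)
  have t_eval: "t (a, tensor_pairing L b c) = brs a (brs b c) x"
    if a: "a \<in> carr (dual L)" "b \<in> carr (dual L)" "c \<in> carr (dual L)" for a b c
  proof -
    have "dual_map L \<delta> (tensor_pairing L b c) = brs b c"
      using dual_bracket_eq[OF a(2,3)] by (simp add: dual_map_def dual_bracket_def)
    then show ?thesis
      using T(2)[OF a(1) tensor_pairing(1)[OF vL a(2,3)] \<delta>_in[OF x]] a x
      by (simp add: t_def dual_map_id \<delta>_eval rules)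
  qed
  have "t + cyc L t + cyc L (cyc L t) = 0"
  proof (rule tensor3_eq_0[OF vL fin])
    show "t + cyc L t + cyc L (cyc L t) \<in> carr ?LLL"
      by (intro vspace_closed(2)[OF is_vspace_tensor] t c)
    fix a b c' assume a: "a \<in> carr (dual L)" "b \<in> carr (dual L)" "c' \<in> carr (dual L)"
    have "brs a (brs b c') + brs b (brs c' a) + brs c' (brs a b) = 0"
      using a by (rule lie_algebra_rules(5)[OF lie_dual])
    then have "(brs a (brs b c') + brs b (brs c' a) + brs c' (brs a b)) x = 0" by simp
    moreover have "cyc L t (a, tensor_pairing L b c') = brs c' (brs a b) x"
      using cyc(2)[OF vL a t] a by (simp add: t_eval)
    moreover have "cyc L (cyc L t) (a, tensor_pairing L b c') = brs b (brs c' a) x"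
      using cyc(2)[OF vL a c[OF t]] cyc(2)[OF vL a(3,1,2) t] a by (simp add: t_eval)
    ultimately show "(t + cyc L t + cyc L (cyc L t)) (a, tensor_pairing L b c') = 0"
      using a by (simp add: t_eval algebra_simps)
  qed
  then show "tensor_map L L L ?LL id \<delta> (\<delta> x) + cyc L (tensor_map L L L ?LL id \<delta> (\<delta> x))
      + cyc L (cyc L (tensor_map L L L ?LL id \<delta> (\<delta> x))) = 0"
    by (simp only: t_def)
qed (fact vL lin_\<delta>)+

lemma diff_lie_coalgebra_\<delta>:
  assumes D: "lin L L D" and "diff_lie_algebra lam (dual L) brs (dual_map L D)"
  shows "diff_lie_coalgebra lam L \<delta> D"
  unfolding diff_lie_coalgebra_def
proof (intro conjI ballI)
  fix x assume x: "x \<in> carr L"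
  have Dx: "D x \<in> carr L" using D x by (simp add: lin_def)
  note vT = is_vspace_tensor[of L L]
  show "\<delta> (D x) = tensor_map L L L L D id (\<delta> x) + tensor_map L L L L id D (\<delta> x)
      + smul (tensor L L) lam (tensor_map L L L L D D (\<delta> x))" (is "_ = ?r")
  proof (rule tensor_eqI)
    show "\<delta> (D x) \<in> carr (tensor L L)" by (rule \<delta>_in[OF Dx])
    show "?r \<in> carr (tensor L L)"
      by (intro vspace_closed(2,5)[OF vT] tensor_map_in D lin_id x)
    fix a b assume a: "a \<in> carr (dual L)" "b \<in> carr (dual L)"
    have "dual_map L D (brs a b) = brs (dual_map L D a) b + brs a (dual_map L D b)
        + fsmul lam (brs (dual_map L D a) (dual_map L D b))"
      using assms(2) a by (simp add: diff_lie_algebra_def)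
    from fun_cong[OF this, of x] show "\<delta> (D x) (a, b) = ?r (a, b)"
      using a x Dx D lin_id[of L]
      by (simp add: \<delta>_eval tensor_map_\<delta> dual_map_id) (simp add: dual_map_def)
  qed
qed (fact lie_coalgebra_\<delta> D)+

lemma lie_bialgebra_iff_cocycle: "lie_bialgebra L br \<delta> \<longleftrightarrow> cocycle"
proof -
  note vT = is_vspace_tensor[of L L]
  let ?r = "\<lambda>x y. (tensor_map L L L L (br x) id (\<delta> y) + tensor_map L L L L id (br x) (\<delta> y))
      - (tensor_map L L L L (br y) id (\<delta> x) + tensor_map L L L L id (br y) (\<delta> x))"
  have lin_br: "lin L L (br x)" if "x \<in> carr L" for x
    using lie_algebra_rules(2)[OF lie] that by (simp add: bilin_def)
  have ad_dual: "dual_map L (br x) a = - \<rho> x a" for x a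
    by (auto simp: dual_map_def coad_def)
  have r_eval: "?r x y (a, b) = brs (\<rho> y a) b x + brs a (\<rho> y b) x - brs (\<rho> x a) b y - brs a (\<rho> x b) y"
    if "x \<in> carr L" "y \<in> carr L" "a \<in> carr (dual L)" "b \<in> carr (dual L)" for x y a b
    using that lin_br lin_id[of L]
    by (simp add: tensor_map_\<delta> dual_map_id ad_dual rules \<rho>_spec)
  have "\<delta> (br x y) = ?r x y \<longleftrightarrow> (\<forall>a\<in>carr (dual L). \<forall>b\<in>carr (dual L).
      brs a b (br x y) = brs (\<rho> y a) b x + brs a (\<rho> y b) x - brs (\<rho> x a) b y - brs a (\<rho> x b) y)"
    if x: "x \<in> carr L" and y: "y \<in> carr L" for x y
  proof -
    have br_in: "br x y \<in> carr L" using x y by (simp add: rules)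
    have "?r x y \<in> carr (tensor L L)"
      by (intro vspace_closed(2,3)[OF vT] tensor_map_in lin_br lin_id x y)
    note eqI = tensor_eqI[OF \<delta>_in[OF br_in] this]
    show ?thesis
    proof (intro iffI ballI)
      fix a b assume eq: "\<delta> (br x y) = ?r x y" and a: "a \<in> carr (dual L)" "b \<in> carr (dual L)"
      show "brs a b (br x y) = brs (\<rho> y a) b x + brs a (\<rho> y b) x - brs (\<rho> x a) b y - brs a (\<rho> x b) y"
        using \<delta>_eval[OF a br_in] r_eval[OF x y a] unfolding eq by (simp only:)
    next
      assume eq: "\<forall>a\<in>carr (dual L). \<forall>b\<in>carr (dual L). brs a b (br x y)
        = brs (\<rho> y a) b x + brs a (\<rho> y b) x - brs (\<rho> x a) b y - brs a (\<rho> x b) y"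
      show "\<delta> (br x y) = ?r x y"
      proof (rule eqI)
        fix a b assume a: "a \<in> carr (dual L)" "b \<in> carr (dual L)"
        show "\<delta> (br x y) (a, b) = ?r x y (a, b)"
          unfolding \<delta>_eval[OF a br_in] r_eval[OF x y a] using eq a by blast
      qed
    qed
  qed
  then show ?thesis
    using lie lie_coalgebra_\<delta> unfolding lie_bialgebra_def cocycle_def by simp
qed

text \<open>
  The conditions correspond one to one: cocycle condition and compatibility of the actions;
  admissibility of \<open>D\<close> and the representation on \<open>L\<^sup>*\<close>; admissibility of \<open>d\<^sup>*\<close> and the representation
  on \<open>L\<close>.  The bracket recovered from \<open>\<delta>\<close> agrees with \<open>brs\<close> on functionals only, hence the passage between
  the two in the proof.
\<close>

theorem bialgebra_iff_matched_pair:
  assumes d: "diff_lie_algebra lam L br d" and lin_D: "lin L L D"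
    and D: "diff_lie_algebra lam (dual L) brs (dual_map L D)"
  shows "diff_lie_bialgebra lam L br d \<delta> D
    \<longleftrightarrow> matched_pair_diff_lie lam L br d (dual L) brs (dual_map L D) h \<rho>"
proof -
  let ?D = "dual_map L D" and ?d = "dual_map L d"
  have lin_d: "lin L L d" using d by (simp add: diff_lie_algebra_def)
  note lin_d' = lin_dual_map[OF lin_d vL]
  have D_in: "?D a \<in> carr (dual L)" if "a \<in> carr (dual L)" for a
    using that by (rule dual_map_in[OF lin_D _ vL])
  have d_in: "?d a \<in> carr (dual L)" if "a \<in> carr (dual L)" for a
    using that by (rule dual_map_in[OF lin_d _ vL])
  have D': "diff_lie_algebra lam (dual L) (dual_bracket L \<delta>) ?D"
    using D lie_algebra_cong[OF lie_dual dual_bracket_eq]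
    by (simp add: diff_lie_algebra_def dual_bracket_eq D_in)
  have "adjoint_admissible lam (dual L) (dual_bracket L \<delta>) ?D ?d
      \<longleftrightarrow> adjoint_admissible lam (dual L) brs ?D ?d"
    unfolding adjoint_admissible_iff[OF D lin_d'] adjoint_admissible_iff[OF D' lin_d']
    by (simp add: dual_bracket_eq D_in d_in)
  then have "diff_lie_bialgebra lam L br d \<delta> D \<longleftrightarrow> cocycle
      \<and> diff_lie_rep lam L br d (dual L) \<rho> ?D \<and> diff_lie_rep lam (dual L) brs ?D L h d"
    using diff_lie_coalgebra_\<delta>[OF lin_D D] d lin_D diff_lie_rep_coad_dual_iff[OF lin_d D]
    by (simp add: diff_lie_bialgebra_def lie_bialgebra_iff_cocycle adjoint_admissible_def[of lam L])
  then show ?thesis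
    using d D by (simp add: matched_pair_diff_lie_def matched_pair_iff_cocycle)
qed

end

theorem theorem3p17:
  fixes lam :: "'k::field"
    and L :: "('k, 'v::ab_group_add) vspace"
    and br :: "'v \<Rightarrow> 'v \<Rightarrow> 'v"
    and d D :: "'v \<Rightarrow> 'v"
    and brs :: "('v \<Rightarrow> 'k) \<Rightarrow> ('v \<Rightarrow> 'k) \<Rightarrow> ('v \<Rightarrow> 'k)"
    and \<delta> :: "'v \<Rightarrow> (('v \<Rightarrow> 'k) \<times> ('v \<Rightarrow> 'k) \<Rightarrow> 'k)"
  assumes "is_vspace L" and "fin_dim L"
    and "diff_lie_algebra lam L br d"
    and "lin L L D"
    and "diff_lie_algebra lam (dual L) brs (dual_map L D)"
    and "lin L (tensor L L) \<delta>"
    and "\<forall>a\<in>carr (dual L). \<forall>b\<in>carr (dual L). \<forall>x\<in>carr L.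
           brs a b x = tensor_pairing L a b (\<delta> x)"
  shows "(manin_triple lam L br d brs (dual_map L D) \<longleftrightarrow> diff_lie_bialgebra lam L br d \<delta> D)
    \<and> (diff_lie_bialgebra lam L br d \<delta> D \<longleftrightarrow>
         matched_pair_diff_lie lam L br d (dual L) brs (dual_map L D) (coad_dual L brs) (coad L br))"
proof -
  interpret comultiplication L br brs \<delta>
    using assms by unfold_locales (simp_all add: diff_lie_algebra_def)
  show ?thesis
    using bialgebra_iff_matched_pair[OF assms(3-5)] manin_triple_iff_matched_pair[OF assms(3,5)]
    by blast
qed

end
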